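(* Let $p_\star := \sqrt{2+\sqrt3}$. For every $p\in(p_\star,2)$ there exists a constant $c_p>0$, depending only on $p$, such that the following holds. For every integer $T\ge1$, all real $L,R>0$, and every schedule $\eta=(\eta_0,\ldots,\eta_{T-1})\in\mathbb{R}_{\ge0}^T$, there exists an integer $d$ with $1\le d\le T+1$ such that, for every initial point $x_0\in\mathbb{R}^d$, there exist a function $f\in\mathcal{F}_{0,L}(\mathbb{R}^d)$ and a minimizer $x_\star\in\operatorname{argmin} f$ satisfying $\|x_0-x_\star\|=R$ such that the gradient descent iterates $$x_{t+1}=x_t-\eta_t\nabla f(x_t),\qquad 0\le t<T,$$ started at $x_0$, satisfy $$f(x_T)-f(x_\star)\ge c_p\,L R^2\,(T+1)^{-p}.$$
   Context: $\mathbb{R}^d$ carries its Euclidean inner product and norm $\|\cdot\|$. For $L>0$, $\mathcal{F}_{0,L}(\mathbb{R}^d)$ denotes the class of differentiable convex functions $f:\mathbb{R}^d\to\mathbb{R}$ that admit at least one minimizer and whose gradient is $L$-Lipschitz, i.e. $\|\nabla f(x)-\nabla f(y)\|\le L\|x-y\|$ for all $x,y\in\mathbb{R}^d$. $\operatorname{argmin} f$ is the set of minimizers of $f$. *)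

theory Defs
  imports Complex_Main "Jordan_Normal_Form.Matrix"
begin

(* The dimension d is quantified inside the statement (it may depend on T, L, R and the
   step sizes), so it cannot be a type parameter.  R^d is therefore the carrier set
   carrier_vec d :: real vec set with the scalar product of Jordan_Normal_Form.Matrix.
   Functions on R^d are represented by total functions real vec => real; only their values
   on carrier_vec d matter. *)

definition vnorm :: "real vec \<Rightarrow> real" where
  "vnorm x = sqrt (x \<bullet> x)"

(* Frechet differentiability at x with gradient g, spelled out with epsilon and delta because
   real vec is not an instance of real_normed_vector. *)
definition has_gradient :: "nat \<Rightarrow> (real vec \<Rightarrow> real) \<Rightarrow> real vec \<Rightarrow> real vec \<Rightarrow> bool" where
  "has_gradient d f g x \<longleftrightarrow>
     g \<in> carrier_vec d \<and>
     (\<forall>\<epsilon>>0. \<exists>\<delta>>0. \<forall>y\<in>carrier_vec d. vnorm (y - x) < \<delta> \<longrightarrow>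
        \<bar>f y - f x - g \<bullet> (y - x)\<bar> \<le> \<epsilon> * vnorm (y - x))"

definition differentiable_Rd :: "nat \<Rightarrow> (real vec \<Rightarrow> real) \<Rightarrow> bool" where
  "differentiable_Rd d f \<longleftrightarrow> (\<forall>x\<in>carrier_vec d. \<exists>g. has_gradient d f g x)"

(* Meaningful where f is differentiable; see has_gradient_imp_gradient below. *)
definition gradient :: "nat \<Rightarrow> (real vec \<Rightarrow> real) \<Rightarrow> real vec \<Rightarrow> real vec" where
  "gradient d f x = (THE g. has_gradient d f g x)"

definition convex_Rd :: "nat \<Rightarrow> (real vec \<Rightarrow> real) \<Rightarrow> bool" where
  "convex_Rd d f \<longleftrightarrow>
     (\<forall>x\<in>carrier_vec d. \<forall>y\<in>carrier_vec d. \<forall>t. 0 \<le> t \<longrightarrow> t \<le> 1 \<longrightarrow>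
        f ((1 - t) \<cdot>\<^sub>v x + t \<cdot>\<^sub>v y) \<le> (1 - t) * f x + t * f y)"

definition argmin_Rd :: "nat \<Rightarrow> (real vec \<Rightarrow> real) \<Rightarrow> real vec set" where
  "argmin_Rd d f = {x \<in> carrier_vec d. \<forall>y\<in>carrier_vec d. f x \<le> f y}"

definition F0L :: "real \<Rightarrow> nat \<Rightarrow> (real vec \<Rightarrow> real) set" where
  "F0L L d = {f. differentiable_Rd d f \<and> convex_Rd d f \<and> argmin_Rd d f \<noteq> {} \<and>
     (\<forall>x\<in>carrier_vec d. \<forall>y\<in>carrier_vec d.
        vnorm (gradient d f x - gradient d f y) \<le> L * vnorm (x - y))}"

primrec gd_iter ::
  "nat \<Rightarrow> (real vec \<Rightarrow> real) \<Rightarrow> (nat \<Rightarrow> real) \<Rightarrow> real vec \<Rightarrow> nat \<Rightarrow> real vec" where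
  "gd_iter d f \<eta> x0 0 = x0"
| "gd_iter d f \<eta> x0 (Suc t) =
     gd_iter d f \<eta> x0 t - \<eta> t \<cdot>\<^sub>v gradient d f (gd_iter d f \<eta> x0 t)"

lemma scalar_prod_self_nonneg: "0 \<le> (x :: real vec) \<bullet> x"
  by (simp add: scalar_prod_def sum_nonneg)

lemma scalar_prod_self_eq_0D:
  fixes x :: "real vec"
  assumes "x \<in> carrier_vec d" and "x \<bullet> x = 0"
  shows "x = 0\<^sub>v d"
proof -
  have "x $ i = 0" if "i < d" for i
  proof -
    have "(\<Sum>i\<in>{0..<d}. x $ i * x $ i) = 0"
      using assms by (simp add: scalar_prod_def)
    then have "\<forall>i\<in>{0..<d}. x $ i * x $ i = 0"
      by (subst (asm) sum_nonneg_eq_0_iff) auto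
    with that show ?thesis by simp
  qed
  with assms(1) show ?thesis by (intro eq_vecI) auto
qed

lemma has_gradient_unique:
  assumes g: "has_gradient d f g x" and h: "has_gradient d f h x" and x: "x \<in> carrier_vec d"
  shows "g = h"
proof (rule ccontr)
  assume "g \<noteq> h"
  define v where "v = g - h"
  have gc: "g \<in> carrier_vec d" and hc: "h \<in> carrier_vec d"
    using g h by (auto simp: has_gradient_def)
  then have vc: "v \<in> carrier_vec d" by (simp add: v_def)
  have "v \<noteq> 0\<^sub>v d"
  proof
    assume "v = 0\<^sub>v d"
    then have "(g - h) $ i = 0" if "i < d" for i
      using that by (simp add: v_def)
    then have "g = h" using gc hc by (intro eq_vecI) auto
    with \<open>g \<noteq> h\<close> show False ..
  qed
  then have "v \<bullet> v > 0"
    using scalar_prod_self_eq_0D[OF vc] scalar_prod_self_nonneg[of v] by fastforce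
  then have np: "vnorm v > 0" and nsq: "v \<bullet> v = vnorm v * vnorm v"
    by (simp_all add: vnorm_def)
  define e where "e = vnorm v / 4"
  have "e > 0" using np by (simp add: e_def)
  obtain d1 where d1: "d1 > 0" and A: "\<forall>y\<in>carrier_vec d. vnorm (y - x) < d1 \<longrightarrow>
        \<bar>f y - f x - g \<bullet> (y - x)\<bar> \<le> e * vnorm (y - x)"
    using g \<open>e > 0\<close> unfolding has_gradient_def by blast
  obtain d2 where d2: "d2 > 0" and B: "\<forall>y\<in>carrier_vec d. vnorm (y - x) < d2 \<longrightarrow>
        \<bar>f y - f x - h \<bullet> (y - x)\<bar> \<le> e * vnorm (y - x)"
    using h \<open>e > 0\<close> unfolding has_gradient_def by blast
  define t where "t = min d1 d2 / (2 * vnorm v)"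
  have t: "t > 0" using d1 d2 np by (simp add: t_def)
  define y where "y = x + t \<cdot>\<^sub>v v"
  have yc: "y \<in> carrier_vec d" using x vc by (simp add: y_def)
  have yx: "y - x = t \<cdot>\<^sub>v v" using x vc by (intro eq_vecI) (auto simp: y_def)
  have "(t \<cdot>\<^sub>v v) \<bullet> (t \<cdot>\<^sub>v v) = (t * vnorm v) * (t * vnorm v)"
    using vc nsq by simp
  then have ny: "vnorm (y - x) = t * vnorm v"
    using t np unfolding yx vnorm_def[of "t \<cdot>\<^sub>v v"] by (simp only: real_sqrt_mult_self) simp
  have "t * vnorm v = min d1 d2 / 2" using np by (simp add: t_def)
  then have "vnorm (y - x) < d1" "vnorm (y - x) < d2" using ny d1 d2 by auto
  then have "\<bar>f y - f x - g \<bullet> (y - x)\<bar> \<le> e * (t * vnorm v)"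
    and "\<bar>f y - f x - h \<bullet> (y - x)\<bar> \<le> e * (t * vnorm v)"
    using A B yc ny by auto
  then have "g \<bullet> (y - x) - h \<bullet> (y - x) \<le> 2 * e * (t * vnorm v)" by linarith
  moreover have "g \<bullet> (y - x) - h \<bullet> (y - x) = t * (vnorm v * vnorm v)"
  proof -
    have "g \<bullet> (y - x) - h \<bullet> (y - x) = t * (g \<bullet> v - h \<bullet> v)"
      using gc hc vc by (simp add: yx right_diff_distrib)
    also have "g \<bullet> v - h \<bullet> v = v \<bullet> v"
      using gc hc vc by (simp add: v_def minus_scalar_prod_distrib)
    finally show ?thesis using nsq by simp
  qed
  ultimately have "t * (vnorm v * vnorm v) \<le> t * (vnorm v * vnorm v) / 2"
    by (simp add: e_def)
  moreover have "t * (vnorm v * vnorm v) > 0" using t np by simp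
  ultimately show False by linarith
qed

lemma has_gradient_imp_gradient:
  assumes "has_gradient d f g x" and "x \<in> carrier_vec d"
  shows "gradient d f x = g"
  unfolding gradient_def using assms by (blast intro: has_gradient_unique)

end

theory Submission
  imports Defs "HOL-Analysis.Function_Topology"
begin

text \<open>
  Single out a set \<open>C\<close> of \<open>N\<close> long steps; the other steps form \<open>N + 1\<close> windows between them. The
  function is the Moreau envelope of the maximum of one affine piece per window and the constant
  \<open>0\<close>. Within a window the iterates follow a constant gradient down to the face of the convex body
  \<open>{f = 0}\<close> cut out by the active piece; the long step ending the window then traverses the body
  and leaves it through the next face. If \<open>\<omega> j\<close> is the length of window \<open>j\<close> (plus \<open>1 / L\<close>) and
  \<open>\<sigma> j\<close> the long step ending it (minus \<open>1 / L\<close>), then the distance to the face of the active piece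
  is multiplied by about \<open>x / sqrt (x + 4)\<close> with \<open>x = \<sigma> j / \<omega> j\<close>. The face normals are the
  vectors \<open>e j - t j e (j - 1)\<close>: only consecutive ones interact, so that neither the earlier nor
  the later pieces become active, whatever the sizes of the steps are.

  The set \<open>C\<close> is chosen to minimise \<open>Z (N + 1) powr (p - 1)\<close>, where \<open>Z\<close> is the sum of the
  \<open>\<omega> j\<close>. Removing a subset from \<open>C\<close> does not decrease this quantity, which bounds the sums of
  the \<open>\<sigma> j\<close> over all subsets from below and hence, by Abel summation, their product by that of a
  power law with exponent \<open>p\<close>. With the arithmetic-geometric mean inequality for the \<open>\<omega> j\<close>
  the product of the factors stays bounded away from \<open>0\<close> as soon as
  \<open>p + 3 < (p - 1)^2 exp p\<close>, which holds for \<open>p \<ge> 19 / 10\<close>.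
\<close>

section \<open>Moreau envelopes of finitely many affine functions\<close>

lemma scalar_prod_diff_self:
  fixes a b :: "real vec"
  assumes "a \<in> carrier_vec d" "b \<in> carrier_vec d"
  shows "(a - b) \<bullet> (a - b) = a \<bullet> a - 2 * (a \<bullet> b) + b \<bullet> b"
  using assms by (simp add: minus_scalar_prod_distrib[of _ d] scalar_prod_minus_distrib[of _ d]
      comm_scalar_prod[of b d a])

lemma scalar_prod_add_self:
  fixes a b :: "real vec"
  assumes "a \<in> carrier_vec d" "b \<in> carrier_vec d"
  shows "(a + b) \<bullet> (a + b) = a \<bullet> a + 2 * (a \<bullet> b) + b \<bullet> b"
  using assms by (simp add: add_scalar_prod_distrib[of _ d] scalar_prod_add_distrib[of _ d]
      comm_scalar_prod[of b d a])

text \<open>Young's inequality, from expanding the squared norm of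
  \<open>a - L \<cdot>\<^sub>v b\<close>.\<close>

lemma scalar_prod_le_half_squares:
  fixes a b :: "real vec"
  assumes a: "a \<in> carrier_vec d" and b: "b \<in> carrier_vec d" and L: "0 < L"
  shows "a \<bullet> b \<le> (a \<bullet> a) / (2 * L) + L / 2 * (b \<bullet> b)"
proof -
  have "0 \<le> (a - L \<cdot>\<^sub>v b) \<bullet> (a - L \<cdot>\<^sub>v b)"
    by (rule scalar_prod_self_nonneg)
  also have "\<dots> = a \<bullet> a - 2 * (L * (a \<bullet> b)) + L * (L * (b \<bullet> b))"
    using a b by (subst scalar_prod_diff_self[of _ d]) auto
  finally show ?thesis
    using L by (simp add: field_simps)
qed

text \<open>The first-order error is squeezed between zero and a multiple of the squared
  distance.\<close>

lemma has_gradient_quadratic_bound: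
  assumes G: "G \<in> carrier_vec d" and L: "0 < L"
    and lower: "\<And>y. y \<in> carrier_vec d \<Longrightarrow> f x + G \<bullet> (y - x) \<le> f y"
    and upper: "\<And>y. y \<in> carrier_vec d \<Longrightarrow> f y \<le> f x + G \<bullet> (y - x) + L / 2 * ((y - x) \<bullet> (y - x))"
  shows "has_gradient d f G x"
  unfolding has_gradient_def
proof (intro conjI allI impI)
  show "G \<in> carrier_vec d" by (rule G)
  fix e :: real assume e: "0 < e"
  show "\<exists>\<delta>>0. \<forall>y\<in>carrier_vec d. vnorm (y - x) < \<delta> \<longrightarrow>
        \<bar>f y - f x - G \<bullet> (y - x)\<bar> \<le> e * vnorm (y - x)"
  proof (intro exI[of _ "2 * e / L"] conjI ballI impI)
    show "0 < 2 * e / L" using e L by simp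
    fix y assume y: "y \<in> carrier_vec d" and small: "vnorm (y - x) < 2 * e / L"
    have sq: "(y - x) \<bullet> (y - x) = vnorm (y - x) * vnorm (y - x)"
      by (simp add: vnorm_def scalar_prod_self_nonneg)
    have nn: "0 \<le> vnorm (y - x)" by (simp add: vnorm_def scalar_prod_self_nonneg)
    have "\<bar>f y - f x - G \<bullet> (y - x)\<bar> \<le> L / 2 * vnorm (y - x) * vnorm (y - x)"
      using lower[OF y] upper[OF y] unfolding sq by (simp add: mult.assoc)
    also have "\<dots> \<le> e * vnorm (y - x)"
      using small L by (intro mult_right_mono nn) (simp add: field_simps)
    finally show "\<bar>f y - f x - G \<bullet> (y - x)\<bar> \<le> e * vnorm (y - x)" .
  qed
qed

section \<open>Compactness of the probability simplex\<close>

definition prob_simplex :: "nat \<Rightarrow> (nat \<Rightarrow> real) set" where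
  "prob_simplex n = {\<alpha>. (\<forall>j. 0 \<le> \<alpha> j) \<and> (\<forall>j>n. \<alpha> j = 0) \<and> (\<Sum>j\<le>n. \<alpha> j) = 1}"

lemma continuous_on_coord: "continuous_on S (\<lambda>\<alpha>. (\<alpha> :: nat \<Rightarrow> real) j)"
  by (rule continuous_on_subset[OF continuous_on_product_coordinates]) simp

text \<open>Weights are functions on all of \<open>nat\<close>, so compactness comes from Tychonoff:
  the simplex is a closed slice of a product of unit intervals and singletons.\<close>

lemma compact_prob_simplex: "compact (prob_simplex n)"
proof -
  define B where "B = (\<Pi>\<^sub>E j\<in>UNIV. if j \<le> n then {0..1::real} else {0})"
  have "compactin (product_topology (\<lambda>_. euclidean) UNIV) B"
    unfolding B_def by (subst compactin_PiE) (auto simp: if_split)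
  then have cB: "compact B" by (simp add: euclidean_product_topology)
  have "closed {\<alpha> :: nat \<Rightarrow> real. (\<Sum>j\<le>n. \<alpha> j) = 1}"
    by (intro closed_Collect_eq continuous_on_sum continuous_on_coord continuous_on_const)
  then have "compact (B \<inter> {\<alpha>. (\<Sum>j\<le>n. \<alpha> j) = 1})"
    using cB by (rule compact_Int_closed[rotated])
  also have "B \<inter> {\<alpha>. (\<Sum>j\<le>n. \<alpha> j) = 1} = prob_simplex n"
  proof (intro equalityI subsetI)
    fix \<alpha> assume "\<alpha> \<in> B \<inter> {\<alpha>. (\<Sum>j\<le>n. \<alpha> j) = 1}"
    then have b: "\<And>j. \<alpha> j \<in> (if j \<le> n then {0..1} else {0})" and s: "(\<Sum>j\<le>n. \<alpha> j) = 1"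
      by (auto simp: B_def PiE_def Pi_def)
    have "0 \<le> \<alpha> j" for j using b[of j] by (auto split: if_splits)
    moreover have "\<alpha> j = 0" if "j > n" for j using b[of j] that by auto
    ultimately show "\<alpha> \<in> prob_simplex n" using s by (simp add: prob_simplex_def)
  next
    fix \<alpha> assume a: "\<alpha> \<in> prob_simplex n"
    then have "\<alpha> j \<le> 1" if "j \<le> n" for j
      using member_le_sum[of j "{..n}" \<alpha>] that by (auto simp: prob_simplex_def)
    then show "\<alpha> \<in> B \<inter> {\<alpha>. (\<Sum>j\<le>n. \<alpha> j) = 1}"
      using a by (auto simp: B_def PiE_def Pi_def extensional_def prob_simplex_def)
  qed
  finally show ?thesis .
qed

section \<open>The envelope in dual form and its smoothness\<close>

locale affine_pieces =
  fixes d n :: nat and L :: real and g :: "nat \<Rightarrow> real vec" and \<beta> :: "nat \<Rightarrow> real"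
  assumes L: "0 < L" and g: "\<And>j. g j \<in> carrier_vec d"
begin

definition piece :: "nat \<Rightarrow> real vec \<Rightarrow> real" where
  "piece j x = \<beta> j + g j \<bullet> x"

definition comb :: "(nat \<Rightarrow> real) \<Rightarrow> real vec" where
  "comb \<alpha> = vec d (\<lambda>k. \<Sum>j\<le>n. \<alpha> j * g j $ k)"

text \<open>Dual objective of the Moreau envelope: by minimax, its maximum over the simplex is the
  minimum over \<open>z\<close> of the largest piece at \<open>z\<close> plus \<open>L / 2\<close>
  times the squared distance from \<open>x\<close> to \<open>z\<close>.\<close>

definition obj :: "real vec \<Rightarrow> (nat \<Rightarrow> real) \<Rightarrow> real" where
  "obj x \<alpha> = (\<Sum>j\<le>n. \<alpha> j * piece j x) - (comb \<alpha> \<bullet> comb \<alpha>) / (2 * L)"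

lemma comb_carrier [simp]: "comb \<alpha> \<in> carrier_vec d"
  by (simp add: comb_def)

lemma g_dim [simp]: "dim_vec (g j) = d"
  using g[of j] by simp

lemma comb_scalar_prod:
  assumes "x \<in> carrier_vec d"
  shows "comb \<alpha> \<bullet> x = (\<Sum>j\<le>n. \<alpha> j * (g j \<bullet> x))"
proof -
  have "comb \<alpha> \<bullet> x = (\<Sum>k<d. \<Sum>j\<le>n. \<alpha> j * g j $ k * x $ k)"
    using assms by (simp add: scalar_prod_def comb_def sum_distrib_right atLeast0LessThan)
  also have "\<dots> = (\<Sum>j\<le>n. \<Sum>k<d. \<alpha> j * g j $ k * x $ k)"
    by (rule sum.swap)
  also have "\<dots> = (\<Sum>j\<le>n. \<alpha> j * (g j \<bullet> x))"
    using assms by (simp add: scalar_prod_def sum_distrib_left mult.assoc atLeast0LessThan)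
  finally show ?thesis .
qed

lemma comb_comb:
  "comb \<alpha> \<bullet> comb \<alpha>' = (\<Sum>i\<le>n. \<Sum>j\<le>n. \<alpha> i * (\<alpha>' j * (g i \<bullet> g j)))"
proof -
  have "g i \<bullet> comb \<alpha>' = (\<Sum>j\<le>n. \<alpha>' j * (g i \<bullet> g j))" for i
    using comb_scalar_prod[OF g[of i], of \<alpha>'] comm_scalar_prod[OF g comb_carrier, of i]
      comm_scalar_prod[OF g g, of i] by simp
  then show ?thesis by (simp add: comb_scalar_prod sum_distrib_left)
qed

lemma ex_maximizer: "\<exists>\<alpha>\<in>prob_simplex n. \<forall>\<alpha>'\<in>prob_simplex n. obj x \<alpha>' \<le> obj x \<alpha>"
proof (rule continuous_attains_sup[OF compact_prob_simplex])
  have "(\<lambda>j. if j = 0 then 1 else 0) \<in> prob_simplex n"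
    by (auto simp: prob_simplex_def)
  then show "prob_simplex n \<noteq> {}" by blast
  show "continuous_on (prob_simplex n) (obj x)"
    unfolding obj_def comb_comb using L
    by (intro continuous_intros continuous_on_coord) auto
qed

text \<open>Optimal weights need not be unique, hence the choice; at points of the space all of them
  have the same \<open>comb\<close>, namely the gradient of the envelope.\<close>

definition maximizer :: "real vec \<Rightarrow> nat \<Rightarrow> real" where
  "maximizer x = (SOME \<alpha>. \<alpha> \<in> prob_simplex n \<and> (\<forall>\<alpha>'\<in>prob_simplex n. obj x \<alpha>' \<le> obj x \<alpha>))"

definition envelope :: "real vec \<Rightarrow> real" where
  "envelope x = obj x (maximizer x)"

lemma maximizer:
  "maximizer x \<in> prob_simplex n"
  "\<alpha> \<in> prob_simplex n \<Longrightarrow> obj x \<alpha> \<le> envelope x"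
proof -
  have "\<exists>\<alpha>. \<alpha> \<in> prob_simplex n \<and> (\<forall>\<alpha>'\<in>prob_simplex n. obj x \<alpha>' \<le> obj x \<alpha>)"
    using ex_maximizer[of x] by blast
  then have *: "maximizer x \<in> prob_simplex n \<and> (\<forall>\<alpha>'\<in>prob_simplex n. obj x \<alpha>' \<le> obj x (maximizer x))"
    unfolding maximizer_def by (rule someI_ex)
  then show "maximizer x \<in> prob_simplex n" by blast
  show "obj x \<alpha> \<le> envelope x" if "\<alpha> \<in> prob_simplex n"
    using * that unfolding envelope_def by blast
qed

lemma sum_pieces_shift:
  assumes "x \<in> carrier_vec d" "y \<in> carrier_vec d"
  shows "(\<Sum>j\<le>n. \<alpha> j * piece j y) = (\<Sum>j\<le>n. \<alpha> j * piece j x) + comb \<alpha> \<bullet> (y - x)"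
  using assms by (simp add: comb_scalar_prod scalar_prod_minus_distrib[OF g] piece_def
      distrib_left right_diff_distrib sum.distrib sum_subtractf)

text \<open>First-order condition of a concave maximisation: moving by a fraction \<open>t\<close>
  towards \<open>\<alpha>'\<close> changes the objective by a term linear in \<open>t\<close> minus
  one quadratic in \<open>t\<close>, so the linear coefficient cannot be positive.\<close>

lemma optimality:
  assumes \<alpha>: "\<alpha> \<in> prob_simplex n" and mx: "obj x \<alpha> = envelope x"
    and \<alpha>': "\<alpha>' \<in> prob_simplex n"
  shows "(\<Sum>j\<le>n. \<alpha>' j * piece j x) - (\<Sum>j\<le>n. \<alpha> j * piece j x)
           \<le> (comb \<alpha> \<bullet> (comb \<alpha>' - comb \<alpha>)) / L"
proof -
  define l where "l = (\<Sum>j\<le>n. \<alpha>' j * piece j x) - (\<Sum>j\<le>n. \<alpha> j * piece j x)"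
  define c where "c = comb \<alpha> \<bullet> (comb \<alpha>' - comb \<alpha>)"
  define q where "q = (comb \<alpha>' - comb \<alpha>) \<bullet> (comb \<alpha>' - comb \<alpha>)"
  have key: "l - c / L \<le> t * (q / (2 * L))" if t: "0 < t" "t \<le> 1" for t
  proof -
    define \<mu> where "\<mu> = (\<lambda>j. (1 - t) * \<alpha> j + t * \<alpha>' j)"
    have "\<mu> \<in> prob_simplex n"
      using \<alpha> \<alpha>' t by (auto simp: prob_simplex_def \<mu>_def sum.distrib simp flip: sum_distrib_left)
    then have "obj x \<mu> \<le> obj x \<alpha>" using maximizer(2) mx by simp
    moreover have "(\<Sum>j\<le>n. \<mu> j * piece j x) = (\<Sum>j\<le>n. \<alpha> j * piece j x) + t * l"
      unfolding \<mu>_def l_def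
      by (simp add: distrib_right sum.distrib sum_distrib_left algebra_simps sum_subtractf)
    moreover have "comb \<mu> \<bullet> comb \<mu> = comb \<alpha> \<bullet> comb \<alpha> + 2 * t * c + t\<^sup>2 * q"
    proof -
      define w where "w = comb \<alpha>' - comb \<alpha>"
      have v: "comb \<mu> = comb \<alpha> + t \<cdot>\<^sub>v w"
        unfolding w_def by (intro eq_vecI) (auto simp: comb_def \<mu>_def algebra_simps sum.distrib sum_subtractf sum_distrib_left)
      have w: "w \<in> carrier_vec d" by (simp add: w_def)
      have "comb \<mu> \<bullet> comb \<mu> = comb \<alpha> \<bullet> comb \<alpha> + 2 * (comb \<alpha> \<bullet> (t \<cdot>\<^sub>v w)) + (t \<cdot>\<^sub>v w) \<bullet> (t \<cdot>\<^sub>v w)"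
        unfolding v using w by (intro scalar_prod_add_self) auto
      then show ?thesis
        unfolding c_def q_def w_def[symmetric] using w by (simp add: power2_eq_square)
    qed
    ultimately have "t * l \<le> (2 * t * c + t\<^sup>2 * q) / (2 * L)"
      by (simp add: obj_def add_divide_distrib)
    also have "\<dots> = t * (c / L + t * (q / (2 * L)))"
      using L by (simp add: field_simps power2_eq_square)
    finally show ?thesis using t by simp
  qed
  have "l - c / L \<le> 0"
  proof (rule field_le_epsilon)
    fix e :: real assume e: "0 < e"
    define r where "r = q / (2 * L)"
    have r: "0 \<le> r" using L by (simp add: r_def q_def scalar_prod_self_nonneg)
    \<comment> \<open>Any admissible \<open>t\<close> with \<open>t * r \<le> e\<close> serves;
      \<open>r + 1\<close> avoids a division by zero.\<close>
    define t where "t = min 1 (e / (r + 1))"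
    have t: "0 < t" "t \<le> 1" using e r by (auto simp: t_def)
    have "t * (r + 1) \<le> e / (r + 1) * (r + 1)"
      using r by (intro mult_right_mono) (auto simp: t_def)
    also have "\<dots> = e" using r by simp
    finally have "t * r \<le> e" using t by (simp add: distrib_left)
    then show "l - c / L \<le> 0 + e" using key[OF t] by (simp add: r_def)
  qed
  then show ?thesis by (simp add: l_def c_def)
qed

text \<open>Weights optimal at \<open>x\<close> stay admissible at \<open>y\<close>, and for fixed
  weights \<open>obj\<close> is affine in the point with gradient
  \<open>comb \<alpha>\<close>.\<close>

lemma envelope_ge:
  assumes \<alpha>: "\<alpha> \<in> prob_simplex n" and mx: "obj x \<alpha> = envelope x"
    and x: "x \<in> carrier_vec d" and y: "y \<in> carrier_vec d"
  shows "envelope x + comb \<alpha> \<bullet> (y - x) \<le> envelope y"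
  using maximizer(2)[OF \<alpha>, of y] mx sum_pieces_shift[OF x y, of \<alpha>] by (simp add: obj_def)

text \<open>For weights \<open>\<alpha>'\<close> optimal at \<open>y\<close>, the optimality
  condition at \<open>x\<close> leaves the scalar product of
  \<open>comb \<alpha>' - comb \<alpha>\<close> with \<open>y - x\<close>, minus the squared norm of
  the former over \<open>2 * L\<close>. Young's inequality bounds exactly this.\<close>

lemma envelope_le:
  assumes \<alpha>: "\<alpha> \<in> prob_simplex n" and mx: "obj x \<alpha> = envelope x"
    and x: "x \<in> carrier_vec d" and y: "y \<in> carrier_vec d"
  shows "envelope y \<le> envelope x + comb \<alpha> \<bullet> (y - x) + L / 2 * ((y - x) \<bullet> (y - x))"
proof -
  define \<alpha>' where "\<alpha>' = maximizer y"
  have \<alpha>': "\<alpha>' \<in> prob_simplex n" by (simp add: \<alpha>'_def maximizer)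
  have yx: "y - x \<in> carrier_vec d" using x y by simp
  have D: "comb \<alpha>' - comb \<alpha> \<in> carrier_vec d" by simp
  have ey: "envelope y = (\<Sum>j\<le>n. \<alpha>' j * piece j x) + comb \<alpha>' \<bullet> (y - x) - (comb \<alpha>' \<bullet> comb \<alpha>') / (2 * L)"
    unfolding envelope_def obj_def sum_pieces_shift[OF x y] \<alpha>'_def by simp
  have ex: "envelope x = (\<Sum>j\<le>n. \<alpha> j * piece j x) - (comb \<alpha> \<bullet> comb \<alpha>) / (2 * L)"
    using mx by (simp add: obj_def)
  note opt = optimality[OF \<alpha> mx \<alpha>']
  have c: "comb \<alpha> \<bullet> (comb \<alpha>' - comb \<alpha>) = comb \<alpha>' \<bullet> comb \<alpha> - comb \<alpha> \<bullet> comb \<alpha>"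
    by (simp add: scalar_prod_minus_distrib[of _ d] comm_scalar_prod[OF comb_carrier comb_carrier])
  have sq: "(comb \<alpha>' - comb \<alpha>) \<bullet> (comb \<alpha>' - comb \<alpha>)
      = comb \<alpha>' \<bullet> comb \<alpha>' - 2 * (comb \<alpha>' \<bullet> comb \<alpha>) + comb \<alpha> \<bullet> comb \<alpha>"
    by (rule scalar_prod_diff_self[of _ d]) auto
  have am: "(comb \<alpha>' - comb \<alpha>) \<bullet> (y - x) \<le>
      ((comb \<alpha>' - comb \<alpha>) \<bullet> (comb \<alpha>' - comb \<alpha>)) / (2 * L) + L / 2 * ((y - x) \<bullet> (y - x))"
    by (rule scalar_prod_le_half_squares[OF D yx L])
  have lin: "(comb \<alpha>' - comb \<alpha>) \<bullet> (y - x) = comb \<alpha>' \<bullet> (y - x) - comb \<alpha> \<bullet> (y - x)"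
    by (rule minus_scalar_prod_distrib[OF comb_carrier comb_carrier yx])
  show ?thesis using opt am unfolding ey ex c sq lin using L
    by (simp add: diff_divide_distrib add_divide_distrib)
qed

lemma has_gradient_envelope:
  assumes "\<alpha> \<in> prob_simplex n" "obj x \<alpha> = envelope x" "x \<in> carrier_vec d"
  shows "has_gradient d envelope (comb \<alpha>) x"
  using assms by (intro has_gradient_quadratic_bound[OF _ L] envelope_ge envelope_le) auto

lemma gradient_envelope:
  assumes "x \<in> carrier_vec d"
  shows "gradient d envelope x = comb (maximizer x)"
  using assms by (intro has_gradient_imp_gradient has_gradient_envelope maximizer)
    (auto simp: envelope_def)

text \<open>Adding the optimality conditions at both points yields cocoercivity of the gradient,
  which Young's inequality turns into the Lipschitz bound.\<close>

lemma gradient_envelope_Lipschitz: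
  assumes x: "x \<in> carrier_vec d" and y: "y \<in> carrier_vec d"
  shows "vnorm (gradient d envelope x - gradient d envelope y) \<le> L * vnorm (x - y)"
proof -
  define a b where "a = comb (maximizer x)" and "b = comb (maximizer y)"
  have [simp]: "a \<in> carrier_vec d" "b \<in> carrier_vec d" by (auto simp: a_def b_def)
  have D: "a - b \<in> carrier_vec d" and xy: "x - y \<in> carrier_vec d" and yx: "y - x \<in> carrier_vec d"
    using x y by auto
  have 1: "(\<Sum>j\<le>n. maximizer y j * piece j x) - (\<Sum>j\<le>n. maximizer x j * piece j x) \<le> (a \<bullet> (b - a)) / L"
    unfolding a_def b_def by (rule optimality) (auto simp: maximizer envelope_def)
  have 2: "(\<Sum>j\<le>n. maximizer x j * piece j y) - (\<Sum>j\<le>n. maximizer y j * piece j y) \<le> (b \<bullet> (a - b)) / L"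
    unfolding a_def b_def by (rule optimality) (auto simp: maximizer envelope_def)
  have s: "(\<Sum>j\<le>n. maximizer x j * piece j y) = (\<Sum>j\<le>n. maximizer x j * piece j x) + a \<bullet> (y - x)"
    "(\<Sum>j\<le>n. maximizer y j * piece j y) = (\<Sum>j\<le>n. maximizer y j * piece j x) + b \<bullet> (y - x)"
    unfolding a_def b_def by (rule sum_pieces_shift[OF x y])+
  have e: "a \<bullet> (b - a) + b \<bullet> (a - b) = - ((a - b) \<bullet> (a - b))"
    by (simp add: scalar_prod_diff_self[of _ d] scalar_prod_minus_distrib[of _ d]
        minus_scalar_prod_distrib[of _ d] comm_scalar_prod[of b d a])
  have "a \<bullet> (y - x) - b \<bullet> (y - x) \<le> (a \<bullet> (b - a) + b \<bullet> (a - b)) / L"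
    using 1 2 unfolding s by (simp add: add_divide_distrib)
  moreover have "a \<bullet> (y - x) - b \<bullet> (y - x) = - ((a - b) \<bullet> (x - y))"
    using x y by (simp add: minus_scalar_prod_distrib[of _ d] scalar_prod_minus_distrib[of _ d])
  ultimately have mono: "((a - b) \<bullet> (a - b)) / L \<le> (a - b) \<bullet> (x - y)"
    unfolding e by simp
  have "(a - b) \<bullet> (x - y) \<le> ((a - b) \<bullet> (a - b)) / (2 * L) + L / 2 * ((x - y) \<bullet> (x - y))"
    by (rule scalar_prod_le_half_squares[OF D xy L])
  with mono have "(a - b) \<bullet> (a - b) \<le> L\<^sup>2 * ((x - y) \<bullet> (x - y))"
    using L by (simp add: field_simps power2_eq_square)
  then have "vnorm (a - b) \<le> sqrt (L\<^sup>2 * ((x - y) \<bullet> (x - y)))"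
    by (simp add: vnorm_def)
  then show ?thesis
    using L x y by (simp add: gradient_envelope a_def b_def vnorm_def real_sqrt_mult)
qed

text \<open>The supporting affine function at the intermediate point is averaged over the two ends,
  where its linear terms cancel.\<close>

lemma envelope_convex: "convex_Rd d envelope"
  unfolding convex_Rd_def
proof (intro ballI allI impI)
  fix x y :: "real vec" and t :: real
  assume x: "x \<in> carrier_vec d" and y: "y \<in> carrier_vec d" and t: "0 \<le> t" "t \<le> 1"
  define z where "z = (1 - t) \<cdot>\<^sub>v x + t \<cdot>\<^sub>v y"
  define G where "G = comb (maximizer z)"
  have z: "z \<in> carrier_vec d" using x y by (simp add: z_def)
  have G: "G \<in> carrier_vec d" by (simp add: G_def)
  have "envelope z + G \<bullet> (w - z) \<le> envelope w" if "w \<in> carrier_vec d" for w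
    unfolding G_def by (rule envelope_ge) (auto simp: maximizer envelope_def z that)
  from this[OF x] this[OF y]
  have "(1 - t) * (envelope z + G \<bullet> (x - z)) + t * (envelope z + G \<bullet> (y - z))
      \<le> (1 - t) * envelope x + t * envelope y"
    using t by (intro add_mono mult_left_mono) auto
  moreover have "(1 - t) * (G \<bullet> (x - z)) + t * (G \<bullet> (y - z)) = 0"
  proof -
    have "G \<bullet> z = (1 - t) * (G \<bullet> x) + t * (G \<bullet> y)"
      using x y G by (simp add: z_def scalar_prod_add_distrib[of _ d])
    then show ?thesis
      using x y z G by (simp add: scalar_prod_minus_distrib[of _ d] algebra_simps)
  qed
  ultimately show "envelope ((1 - t) \<cdot>\<^sub>v x + t \<cdot>\<^sub>v y) \<le> (1 - t) * envelope x + t * envelope y"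
    unfolding z_def[symmetric] by (simp add: algebra_simps)
qed

section \<open>Points where a single piece determines the envelope\<close>

definition vertex :: "nat \<Rightarrow> nat \<Rightarrow> real" where
  "vertex i = (\<lambda>j. if j = i then 1 else 0)"

lemma vertex_mem: "i \<le> n \<Longrightarrow> vertex i \<in> prob_simplex n"
  by (auto simp: vertex_def prob_simplex_def)

lemma comb_vertex: "i \<le> n \<Longrightarrow> comb (vertex i) = g i"
  by (intro eq_vecI) (auto simp: comb_def vertex_def if_distrib[of "\<lambda>c. c * _"] cong: if_cong)

lemma obj_vertex: "i \<le> n \<Longrightarrow> obj x (vertex i) = piece i x - (g i \<bullet> g i) / (2 * L)"
  unfolding obj_def
  by (auto simp: comb_vertex) (auto simp: vertex_def if_distrib[of "\<lambda>c. c * _"] cong: if_cong)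

lemma envelope_ge_piece: "i \<le> n \<Longrightarrow> piece i x - (g i \<bullet> g i) / (2 * L) \<le> envelope x"
  using maximizer(2)[OF vertex_mem] obj_vertex by metis

text \<open>The piece \<open>i\<close> is active at \<open>x\<close> if it attains the maximum of the pieces at the
  proximal point \<open>x - g i / L\<close>.\<close>

definition active :: "nat \<Rightarrow> real vec \<Rightarrow> bool" where
  "active i x \<longleftrightarrow> (\<forall>j\<le>n. piece j x - (g j \<bullet> g i) / L \<le> piece i x - (g i \<bullet> g i) / L)"

text \<open>Averaging the activity inequalities with optimal weights compares the linear parts; the
  quadratic parts are compared by the squared norm of \<open>comb \<alpha> - g i\<close>.\<close>

lemma active_vertex_optimal:
  assumes i: "i \<le> n" and act: "active i x"
  shows "obj x (vertex i) = envelope x"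
proof (rule antisym)
  show "obj x (vertex i) \<le> envelope x" by (rule maximizer(2)[OF vertex_mem[OF i]])
  define \<alpha> where "\<alpha> = maximizer x"
  have \<alpha>: "\<alpha> \<in> prob_simplex n" by (simp add: \<alpha>_def maximizer)
  then have nn: "\<And>j. 0 \<le> \<alpha> j" and s: "(\<Sum>j\<le>n. \<alpha> j) = 1" by (auto simp: prob_simplex_def)
  have "(\<Sum>j\<le>n. \<alpha> j * (piece j x - (g j \<bullet> g i) / L)) \<le> (\<Sum>j\<le>n. \<alpha> j * (piece i x - (g i \<bullet> g i) / L))"
    using act nn by (intro sum_mono mult_left_mono) (auto simp: active_def)
  also have "\<dots> = piece i x - (g i \<bullet> g i) / L"
    using s by (simp flip: sum_distrib_right)
  finally have "(\<Sum>j\<le>n. \<alpha> j * piece j x) - (comb \<alpha> \<bullet> g i) / L \<le> piece i x - (g i \<bullet> g i) / L"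
    by (simp add: right_diff_distrib sum_subtractf comb_scalar_prod[OF g] sum_divide_distrib)
  moreover have "0 \<le> (comb \<alpha> - g i) \<bullet> (comb \<alpha> - g i) / (2 * L)"
    using L by (simp add: scalar_prod_self_nonneg)
  then have "0 \<le> (comb \<alpha> \<bullet> comb \<alpha>) / (2 * L) - (comb \<alpha> \<bullet> g i) / L + (g i \<bullet> g i) / (2 * L)"
    by (simp add: scalar_prod_diff_self[OF comb_carrier g] diff_divide_distrib add_divide_distrib)
  ultimately show "envelope x \<le> obj x (vertex i)"
    unfolding envelope_def obj_vertex[OF i] unfolding obj_def \<alpha>_def[symmetric]
    by (simp add: field_simps)
qed

lemma gradient_active:
  assumes "i \<le> n" "active i x" "x \<in> carrier_vec d"
  shows "gradient d envelope x = g i"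
  using has_gradient_imp_gradient[OF has_gradient_envelope[OF vertex_mem active_vertex_optimal]]
    assms comb_vertex by metis

lemma envelope_active:
  assumes "i \<le> n" "active i x"
  shows "envelope x = piece i x - (g i \<bullet> g i) / (2 * L)"
  using active_vertex_optimal[OF assms] obj_vertex[OF assms(1)] by simp

text \<open>Reduces running gradient descent to exhibiting a sequence that always steps along the
  gradient of an active piece.\<close>

lemma gd_iter_envelope:
  assumes x: "\<And>t. t \<le> T \<Longrightarrow> x t \<in> carrier_vec d"
    and step: "\<And>t. t < T \<Longrightarrow> x (Suc t) = x t - \<eta> t \<cdot>\<^sub>v g (i t)"
    and i: "\<And>t. t < T \<Longrightarrow> i t \<le> n \<and> active (i t) (x t)"
  shows "t \<le> T \<Longrightarrow> gd_iter d envelope \<eta> (x 0) t = x t"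
proof (induction t)
  case (Suc t)
  then show ?case using gradient_active[of "i t" "x t"] i[of t] x[of t] step[of t] by simp
qed simp

lemma envelope_F0L:
  assumes "xs \<in> argmin_Rd d envelope"
  shows "envelope \<in> F0L L d"
proof -
  have "differentiable_Rd d envelope"
    unfolding differentiable_Rd_def
    using has_gradient_envelope[OF maximizer(1)] by (auto simp: envelope_def)
  then show ?thesis
    using assms envelope_convex gradient_envelope_Lipschitz by (auto simp: F0L_def)
qed

end

section \<open>Chains of overshooting steps\<close>

text \<open>No long step follows the last window; the convention \<open>\<sigma> N = 0\<close> lets
  the formulas below cover it too.\<close>

locale overshoot_chain =
  fixes N :: nat and R :: real and \<omega> \<sigma> :: "nat \<Rightarrow> real"
  assumes R: "0 < R"
    and \<omega>: "\<And>j. j \<le> N \<Longrightarrow> 0 < \<omega> j"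
    and \<sigma>: "\<And>j. j < N \<Longrightarrow> 0 < \<sigma> j"
    and \<sigma>_N: "\<sigma> N = 0"
begin

definition ratio :: "nat \<Rightarrow> real" where
  "ratio j = \<sigma> j / \<omega> j"

text \<open>The value makes \<open>(tilt j)\<^sup>2 * (1 + ratio j) = 1\<close>, which
  \<open>overshoot_bound\<close> uses to keep the preceding piece nonpositive. The first direction
  has no predecessor, hence the zero.\<close>

definition tilt :: "nat \<Rightarrow> real" where
  "tilt j = (if j = 0 then 0 else 1 / sqrt (1 + ratio j))"

text \<open>The recursion balances the height above face \<open>Suc j\<close> gained by the
  overshoot past face \<open>j\<close>, which is \<open>tilt (Suc j) * (ratio j * depth j)\<close>,
  against the height lost while descending through window \<open>Suc j\<close>.\<close>

primrec depth :: "nat \<Rightarrow> real" where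
  "depth 0 = R"
| "depth (Suc j) = tilt (Suc j) / (1 + (tilt (Suc j))\<^sup>2) * (ratio j * depth j)"

text \<open>A piece with this slope descends from the depth \<open>depth j\<close> to its zero level exactly in the
  window \<open>j\<close>; the last slope is halved in order to stop half-way, which leaves the final gap.\<close>

definition slope :: "nat \<Rightarrow> real" where
  "slope j = (if j < N then depth j / \<omega> j else if j = N then depth N / (2 * \<omega> N) else 0)"

definition dir :: "nat \<Rightarrow> real vec" where
  "dir j = vec (Suc N) (\<lambda>k. (if k = j then 1 else 0) - (if Suc k = j then tilt j else 0))"

text \<open>The sum of \<open>c l\<close> times \<open>dir l\<close> over
  \<open>l \<le> Suc N\<close>, in coordinates.\<close>

definition lincomb_dir :: "(nat \<Rightarrow> real) \<Rightarrow> real vec" where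
  "lincomb_dir c = vec (Suc N) (\<lambda>k. c k - tilt (Suc k) * c (Suc k))"

text \<open>Coefficients (along the directions \<open>- dir l\<close>, relative to the starting point) of the
  iterates and proximal points: the windows before \<open>i\<close> have been traversed completely,
  the window \<open>i\<close> up to the depth \<open>\<theta>\<close>.\<close>

definition path :: "nat \<Rightarrow> real \<Rightarrow> nat \<Rightarrow> real" where
  "path i \<theta> l = (if l < i then depth l + ratio l * depth l else if l = i then \<theta> else 0)"

lemma ratio_nonneg: "j \<le> N \<Longrightarrow> 0 \<le> ratio j"
  using \<omega>[of j] \<sigma>[of j] \<sigma>_N by (cases "j = N") (auto simp: ratio_def)

lemma tilt_0 [simp]: "tilt 0 = 0"
  by (simp add: tilt_def)

lemma tilt_nonneg: "j \<le> N \<Longrightarrow> 0 \<le> tilt j"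
  using ratio_nonneg[of j] by (simp add: tilt_def)

lemma tilt_sq: "0 < j \<Longrightarrow> j \<le> N \<Longrightarrow> (tilt j)\<^sup>2 * (1 + ratio j) = 1"
  using ratio_nonneg[of j] by (simp add: tilt_def power_divide)

lemma one_plus_tilt_sq_pos: "0 < 1 + (tilt j)\<^sup>2"
  by (simp add: add_pos_nonneg)

lemma depth_nonneg: "j \<le> N \<Longrightarrow> 0 \<le> depth j"
proof (induction j)
  case (Suc j)
  then show ?case
    using tilt_nonneg[of "Suc j"] ratio_nonneg[of j] one_plus_tilt_sq_pos[of "Suc j"] by simp
qed (use R in simp)

lemma depth_Suc_tilt:
  "(1 + (tilt (Suc j))\<^sup>2) * depth (Suc j) = tilt (Suc j) * (ratio j * depth j)"
  using one_plus_tilt_sq_pos[of "Suc j"] by simp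

text \<open>The left side is how far window \<open>Suc j\<close>, long step included, moves back
  towards face \<open>j\<close>. By the choice of the tilt it equals the overshoot past that face
  divided by \<open>1 + (tilt (Suc j))\<^sup>2\<close>.\<close>

lemma overshoot_bound:
  assumes "Suc j \<le> N"
  shows "tilt (Suc j) * (depth (Suc j) + ratio (Suc j) * depth (Suc j)) \<le> ratio j * depth j"
proof -
  define t where "t = tilt (Suc j)"
  have nn: "0 \<le> ratio j * depth j"
    using assms ratio_nonneg depth_nonneg by simp
  have "t * (depth (Suc j) + ratio (Suc j) * depth (Suc j))
      = (t\<^sup>2 * (1 + ratio (Suc j))) * (ratio j * depth j) / (1 + t\<^sup>2)"
    by (simp add: t_def[symmetric] power2_eq_square algebra_simps add_divide_distrib)
  also have "\<dots> = ratio j * depth j / (1 + t\<^sup>2)"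
    using tilt_sq[of "Suc j"] assms by (simp add: t_def)
  also have "\<dots> \<le> ratio j * depth j"
    using nn by (simp add: divide_le_eq mult_le_cancel_left1 add_pos_nonneg) 
  finally show ?thesis by (simp add: t_def)
qed

lemma dir_carrier [simp]: "dir j \<in> carrier_vec (Suc N)"
  by (simp add: dir_def)

lemma lincomb_dir_carrier [simp]: "lincomb_dir c \<in> carrier_vec (Suc N)"
  by (simp add: lincomb_dir_def)

lemma dir_scalar_prod:
  assumes v: "v \<in> carrier_vec (Suc N)" and j: "j \<le> N"
  shows "dir j \<bullet> v = v $ j - tilt j * v $ (j - 1)"
proof -
  have "dir j \<bullet> v = (\<Sum>k<Suc N. (if k = j then v $ k else 0) - (if Suc k = j then tilt j * v $ k else 0))"
    using v unfolding scalar_prod_def dir_def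
    by (intro sum.cong) (auto simp: atLeast0LessThan)
  also have "\<dots> = v $ j - (\<Sum>k<Suc N. if Suc k = j then tilt j * v $ k else 0)"
    using j by (simp add: sum_subtractf del: sum.lessThan_Suc)
  also have "(\<Sum>k<Suc N. if Suc k = j then tilt j * v $ k else 0) = tilt j * v $ (j - 1)"
  proof (cases j)
    case (Suc i)
    then show ?thesis using j by (simp del: sum.lessThan_Suc)
  qed simp
  finally show ?thesis .
qed

text \<open>The Gram matrix of the directions is tridiagonal. For \<open>j = 0\<close> the truncated
  index \<open>j - 1\<close> is harmless because \<open>tilt 0 = 0\<close>.\<close>

lemma dir_lincomb_dir:
  assumes j: "j \<le> N"
  shows "dir j \<bullet> lincomb_dir c =
    (1 + (tilt j)\<^sup>2) * c j - tilt (Suc j) * c (Suc j) - tilt j * c (j - 1)"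
proof (cases j)
  case 0
  then show ?thesis by (simp add: dir_scalar_prod lincomb_dir_def)
next
  case (Suc i)
  then show ?thesis
    using j by (simp add: dir_scalar_prod lincomb_dir_def power2_eq_square algebra_simps)
qed

text \<open>The height of the point with coefficients \<open>path i \<theta>\<close> above the face \<open>j\<close>, which is
  normal to \<open>dir j\<close> and touches the path at the end of the window \<open>j\<close>.\<close>

definition height :: "nat \<Rightarrow> nat \<Rightarrow> real \<Rightarrow> real" where
  "height j i \<theta> = dir j \<bullet> lincomb_dir (\<lambda>l. path j (depth j) l - path i \<theta> l)"

lemma height_same: "i \<le> N \<Longrightarrow> height i i \<theta> = (1 + (tilt i)\<^sup>2) * (depth i - \<theta>)"
  unfolding height_def by (subst dir_lincomb_dir) (cases i; auto simp: path_def)+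

lemma height_nonpos:
  assumes i: "i \<le> N" and j: "j \<le> N" and ij: "i \<noteq> j" and \<theta>: "0 \<le> \<theta>" "\<theta> \<le> depth i"
  shows "height j i \<theta> \<le> 0"
proof (cases "i < j")
  case True
  \<comment> \<open>A face still ahead sees only the coefficient of window \<open>k\<close>, which
    so far is at most \<open>depth k\<close>; by the recursion its height would be zero exactly at
    \<open>depth k\<close>.\<close>
  then obtain k where k: "j = Suc k" by (cases j) auto
  have "height j i \<theta> = - tilt j * (depth k - (if k = i then \<theta> else 0))"
    unfolding height_def dir_lincomb_dir[OF j] using True k depth_Suc_tilt[of k]
    by (simp add: path_def algebra_simps del: depth.simps)
  moreover have "0 \<le> depth k" using j k by (intro depth_nonneg) simp
  ultimately show ?thesis
    using tilt_nonneg[OF j] \<theta> by (auto intro!: mult_nonneg_nonneg)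
next
  case False
  with ij have ji: "j < i" by simp
  \<comment> \<open>For a face already crossed, only the next window moves back towards it, against
    the overshoot past it.\<close>
  have e: "height j i \<theta> = tilt (Suc j) * path i \<theta> (Suc j) - (1 + (tilt j)\<^sup>2) * (ratio j * depth j)"
    unfolding height_def dir_lincomb_dir[OF j] using ji
    by (cases j) (simp_all add: path_def algebra_simps del: depth.simps)
  have Sj: "Suc j \<le> N" using ji i by simp
  have "path i \<theta> (Suc j) \<le> depth (Suc j) + ratio (Suc j) * depth (Suc j)"
    using ji \<theta> ratio_nonneg[OF Sj] depth_nonneg[OF Sj] by (auto simp: path_def not_less simp del: depth.simps)
      (metis add_increasing2 le_antisym less_eq_Suc_le mult_nonneg_nonneg)
  then have "tilt (Suc j) * path i \<theta> (Suc j) \<le> ratio j * depth j"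
    using overshoot_bound[OF Sj] tilt_nonneg[OF Sj] by (meson mult_left_mono order_trans)
  also have "\<dots> \<le> (1 + (tilt j)\<^sup>2) * (ratio j * depth j)"
    using ratio_nonneg[OF j] depth_nonneg[OF j] by (simp add: distrib_right)
  finally show ?thesis unfolding e by simp
qed

text \<open>The step to \<open>depth (Suc j)\<close> involves \<open>ratio j\<close> directly and
  \<open>ratio (Suc j)\<close> through the tilt. The last factor of the claim holds the contribution
  of the newest ratio until the next step completes it.\<close>

lemma depth_sq_ge:
  assumes "j \<le> N"
  shows "R\<^sup>2 * (\<Prod>l<j. (ratio l)\<^sup>2 / (ratio l + 4)) * ((1 + ratio j) / (2 + ratio j)\<^sup>2) \<le> (depth j)\<^sup>2"
  using assms
proof (induction j)
  case 0
  have "0 \<le> ratio 0" using ratio_nonneg by simp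
  then have "(1 + ratio 0) / (2 + ratio 0)\<^sup>2 \<le> 1"
    by (simp add: divide_le_eq power2_eq_square algebra_simps)
  then have "R\<^sup>2 * ((1 + ratio 0) / (2 + ratio 0)\<^sup>2) \<le> R\<^sup>2 * 1"
    by (intro mult_left_mono) auto
  then show ?case by simp
next
  case (Suc j)
  define x y where "x = ratio j" and "y = ratio (Suc j)"
  define P where "P = R\<^sup>2 * (\<Prod>l<j. (ratio l)\<^sup>2 / (ratio l + 4))"
  have x: "0 \<le> x" and y: "0 \<le> y" using Suc.prems ratio_nonneg by (auto simp: x_def y_def)
  have P: "0 \<le> P" unfolding P_def using Suc.prems
    by (intro mult_nonneg_nonneg prod_nonneg) (auto intro!: divide_nonneg_nonneg add_nonneg_nonneg ratio_nonneg)
  have \<tau>: "(tilt (Suc j))\<^sup>2 = 1 / (1 + y)"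
    using y by (simp add: tilt_def y_def power_divide)
  have "(depth (Suc j))\<^sup>2 = (tilt (Suc j))\<^sup>2 / (1 + (tilt (Suc j))\<^sup>2)\<^sup>2 * (x\<^sup>2 * (depth j)\<^sup>2)"
    by (simp add: x_def power_mult_distrib power_divide)
  also have "(tilt (Suc j))\<^sup>2 / (1 + (tilt (Suc j))\<^sup>2)\<^sup>2 = (1 + y) / (2 + y)\<^sup>2"
  proof -
    have "1 + 1 / (1 + y) = (2 + y) / (1 + y)" using y by (simp add: field_simps)
    then show ?thesis unfolding \<tau> using y by (simp add: power_divide power2_eq_square)
  qed
  finally have d: "(depth (Suc j))\<^sup>2 = (1 + y) / (2 + y)\<^sup>2 * (x\<^sup>2 * (depth j)\<^sup>2)" .
  \<comment> \<open>The origin of the denominator \<open>x + 4\<close>; the two sides differ by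
    \<open>x\<close>.\<close>
  have "(2 + x)\<^sup>2 \<le> (1 + x) * (x + 4)"
    using x by (simp add: power2_eq_square algebra_simps)
  then have "1 / (x + 4) \<le> (1 + x) / (2 + x)\<^sup>2"
    using x by (subst pos_le_divide_eq) (auto simp: divide_le_eq)
  then have "P * (x\<^sup>2 / (x + 4)) \<le> x\<^sup>2 * (P * ((1 + x) / (2 + x)\<^sup>2))"
    using P mult_left_mono[of "1 / (x + 4)" "(1 + x) / (2 + x)\<^sup>2" "P * x\<^sup>2"] by (simp add: mult_ac)
  also have "\<dots> \<le> x\<^sup>2 * (depth j)\<^sup>2"
    using Suc.IH Suc.prems by (intro mult_left_mono) (auto simp: P_def x_def)
  finally have "(1 + y) / (2 + y)\<^sup>2 * (P * (x\<^sup>2 / (x + 4))) \<le> (1 + y) / (2 + y)\<^sup>2 * (x\<^sup>2 * (depth j)\<^sup>2)"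
    using y by (intro mult_left_mono) auto
  then show ?case unfolding d by (simp add: P_def x_def y_def mult_ac)
qed

lemma depth_N_sq_ge: "R\<^sup>2 / 4 * (\<Prod>l<N. (ratio l)\<^sup>2 / (ratio l + 4)) \<le> (depth N)\<^sup>2"
  using depth_sq_ge[of N] by (simp add: ratio_def \<sigma>_N power2_eq_square)

section \<open>Realisation of a chain by a smooth convex function\<close>

definition touch :: "real vec \<Rightarrow> nat \<Rightarrow> real vec" where
  "touch x0 j = x0 - lincomb_dir (path j (depth j))"

definition offset :: "real vec \<Rightarrow> nat \<Rightarrow> real" where
  "offset x0 j = - slope j * (dir j \<bullet> touch x0 j)"

lemma slope_nonneg: "0 \<le> slope j"
  using depth_nonneg[of j] \<omega>[of j] by (auto simp: slope_def)

text \<open>Here \<open>\<iota> t\<close> is the window of step \<open>t\<close>, and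
  \<open>A t l\<close> is the length spent in window \<open>l\<close> before it. The hypotheses on
  \<open>A\<close> make the iterates follow \<open>path\<close>; the slack \<open>1 / L\<close> in
  the current window pays for the passage to the proximal point, where activity is tested.\<close>

lemma hard_function:
  fixes L :: real and \<eta> :: "nat \<Rightarrow> real" and \<iota> :: "nat \<Rightarrow> nat" and T :: nat
  defines "A \<equiv> \<lambda>t l. \<Sum>\<tau> | \<tau> < t \<and> \<iota> \<tau> = l. \<eta> \<tau>"
  assumes L: "0 < L"
    and \<iota>_N: "\<And>t. t \<le> T \<Longrightarrow> \<iota> t \<le> N" and \<iota>_T: "\<iota> T = N"
    and past: "\<And>t l. t \<le> T \<Longrightarrow> l < \<iota> t \<Longrightarrow> A t l = \<omega> l + \<sigma> l"
    and present: "\<And>t. t \<le> T \<Longrightarrow> 0 \<le> A t (\<iota> t) \<and> A t (\<iota> t) + 1 / L \<le> \<omega> (\<iota> t)"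
    and future: "\<And>t l. t \<le> T \<Longrightarrow> \<iota> t < l \<Longrightarrow> A t l = 0"
    and x0: "x0 \<in> carrier_vec (Suc N)"
  shows "\<exists>f\<in>F0L L (Suc N). \<exists>xs\<in>argmin_Rd (Suc N) f. vnorm (x0 - xs) = R \<and>
           (depth N)\<^sup>2 / (4 * \<omega> N) \<le> f (gd_iter (Suc N) f \<eta> x0 T) - f xs"
proof -
  define g where "g = (\<lambda>j. slope j \<cdot>\<^sub>v dir j)"
  \<comment> \<open>The piece \<open>Suc N\<close> has slope zero and serves as the constant
    \<open>0\<close>.\<close>
  interpret affine_pieces "Suc N" "Suc N" L g "offset x0"
    by unfold_locales (auto simp: L g_def)
  define pos where "pos = (\<lambda>i \<theta>. x0 - lincomb_dir (path i \<theta>))"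
  have pos_carrier [simp]: "pos i \<theta> \<in> carrier_vec (Suc N)" for i \<theta>
    using x0 by (simp add: pos_def)
  have piece_pos: "piece j (pos i \<theta>) = slope j * height j i \<theta>" for i j \<theta>
  proof -
    have "lincomb_dir (\<lambda>l. path j (depth j) l - path i \<theta> l) = pos i \<theta> - touch x0 j"
      using x0 by (intro eq_vecI) (auto simp: pos_def touch_def lincomb_dir_def algebra_simps)
    moreover have "touch x0 j \<in> carrier_vec (Suc N)" using x0 by (simp add: touch_def)
    ultimately show ?thesis
      unfolding piece_def
      by (simp add: offset_def g_def height_def scalar_prod_minus_distrib[of _ "Suc N"]
          smult_scalar_prod_distrib[OF dir_carrier pos_carrier] right_diff_distrib)
  qed
  have prox: "piece j (pos i (\<theta> + slope i / L)) = piece j (pos i \<theta>) - (g j \<bullet> g i) / L" if "i \<le> N" for i j \<theta>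
  proof -
    \<comment> \<open>The proximal displacement is along \<open>- g i\<close>, so it merely advances
      the depth within window \<open>i\<close>.\<close>
    have "pos i (\<theta> + slope i / L) = pos i \<theta> - (1 / L) \<cdot>\<^sub>v g i"
      using x0 that
      by (intro eq_vecI)
        (auto simp: pos_def lincomb_dir_def path_def g_def dir_def algebra_simps, metis Suc_lessI)
    then show ?thesis
      by (simp add: piece_def scalar_prod_minus_distrib[OF g pos_carrier] g)
  qed
  \<comment> \<open>Until the path touches face \<open>i\<close>, no piece other than
    \<open>i\<close> is positive.\<close>
  have piece_le: "piece j (pos i \<theta>) \<le> piece i (pos i \<theta>) \<and> 0 \<le> piece i (pos i \<theta>)"
    if "i \<le> N" "j \<le> Suc N" "0 \<le> \<theta>" "\<theta> \<le> depth i" for i j \<theta>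
  proof -
    have nn: "0 \<le> height i i \<theta>"
      using that height_same[of i \<theta>] by (simp add: add_nonneg_nonneg)
    show ?thesis
    proof (cases "j = Suc N")
      case True
      then show ?thesis using nn slope_nonneg by (simp add: piece_pos slope_def)
    next
      case False
      have "slope j * height j i \<theta> \<le> 0" if "j \<noteq> i"
        using that \<open>j \<le> Suc N\<close> False \<open>i \<le> N\<close> \<open>0 \<le> \<theta>\<close> \<open>\<theta> \<le> depth i\<close> height_nonpos[of i j \<theta>] slope_nonneg[of j]
        by (simp add: mult_nonneg_nonpos)
      moreover have "0 \<le> slope i * height i i \<theta>" using nn slope_nonneg by simp
      ultimately show ?thesis unfolding piece_pos by (cases "j = i") auto
    qed
  qed
  have slope_\<omega>: "slope j * \<omega> j \<le> depth j" if "j \<le> N" for j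
    using that \<omega>[of j] depth_nonneg[of j] by (auto simp: slope_def)

  define \<theta> where "\<theta> t = slope (\<iota> t) * A t (\<iota> t)" for t
  define x where "x t = pos (\<iota> t) (\<theta> t)" for t
  have \<theta>: "0 \<le> \<theta> t" "\<theta> t + slope (\<iota> t) / L \<le> slope (\<iota> t) * \<omega> (\<iota> t)" if "t \<le> T" for t
  proof -
    show "0 \<le> \<theta> t" using present[OF that] slope_nonneg by (simp add: \<theta>_def)
    have "slope (\<iota> t) * (A t (\<iota> t) + 1 / L) \<le> slope (\<iota> t) * \<omega> (\<iota> t)"
      using present[OF that] slope_nonneg by (intro mult_left_mono) auto
    then show "\<theta> t + slope (\<iota> t) / L \<le> slope (\<iota> t) * \<omega> (\<iota> t)"
      by (simp add: \<theta>_def distrib_left)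
  qed
  \<comment> \<open>In a completed window, \<open>\<omega> l\<close> accounts for the descent to the
    face and \<open>\<sigma> l\<close> for the overshoot.\<close>
  have path_eq: "path (\<iota> t) (\<theta> t) l = slope l * A t l" if t: "t \<le> T" for t l
  proof -
    consider "l < \<iota> t" | "l = \<iota> t" | "\<iota> t < l" by linarith
    then show ?thesis
    proof cases
      case 1
      then have "l < N" using \<iota>_N[OF t] by simp
      then show ?thesis using 1 past[OF t 1] \<omega>[of l]
        by (simp add: path_def slope_def ratio_def field_simps)
    qed (use future[OF t] in \<open>auto simp: path_def \<theta>_def\<close>)
  qed
  have x_Suc: "x (Suc t) = x t - \<eta> t \<cdot>\<^sub>v g (\<iota> t)" if t: "t < T" for t
  proof -
    have "A (Suc t) l = A t l + (if l = \<iota> t then \<eta> t else 0)" for l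
    proof -
      have "{\<tau>. \<tau> < Suc t \<and> \<iota> \<tau> = l} = {\<tau>. \<tau> < t \<and> \<iota> \<tau> = l} \<union> (if l = \<iota> t then {t} else {})"
        by (auto simp: less_Suc_eq)
      then show ?thesis unfolding A_def by simp
    qed
    then have "path (\<iota> (Suc t)) (\<theta> (Suc t)) l = path (\<iota> t) (\<theta> t) l + (if l = \<iota> t then slope l * \<eta> t else 0)" for l
      using t by (simp add: path_eq distrib_left)
    then show ?thesis
      unfolding x_def pos_def using x0 \<iota>_N[of t] t
      by (intro eq_vecI) (auto simp: lincomb_dir_def g_def dir_def algebra_simps)
  qed
  have act: "active (\<iota> t) (x t)" if t: "t \<le> T" for t
    unfolding active_def x_def
  proof (intro allI impI)
    fix j assume j: "j \<le> Suc N"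
    have "\<theta> t + slope (\<iota> t) / L \<le> depth (\<iota> t)" using \<theta>(2)[OF t] slope_\<omega>[OF \<iota>_N[OF t]] by linarith
    moreover have "0 \<le> \<theta> t + slope (\<iota> t) / L" using \<theta>(1)[OF t] slope_nonneg L by simp
    ultimately show "piece j (pos (\<iota> t) (\<theta> t)) - g j \<bullet> g (\<iota> t) / L
        \<le> piece (\<iota> t) (pos (\<iota> t) (\<theta> t)) - g (\<iota> t) \<bullet> g (\<iota> t) / L"
      using piece_le[OF \<iota>_N[OF t] j] prox[OF \<iota>_N[OF t]] by metis
  qed
  have "A 0 l = 0" for l by (simp add: A_def)
  then have x_0: "x 0 = x0"
    unfolding x_def pos_def using x0 path_eq[of 0]
    by (intro eq_vecI) (auto simp: lincomb_dir_def)
  have "gd_iter (Suc N) envelope \<eta> (x 0) T = x T"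
  proof (rule gd_iter_envelope[where i = \<iota> and T = T])
    show "\<iota> t \<le> Suc N \<and> active (\<iota> t) (x t)" if "t < T" for t
      using that act[of t] \<iota>_N[of t] by simp
    show "x t \<in> carrier_vec (Suc N)" for t by (simp add: x_def)
  qed (simp_all add: x_Suc)
  then have gd: "gd_iter (Suc N) envelope \<eta> x0 T = x T" by (simp add: x_0)

  \<comment> \<open>The point where face \<open>0\<close> would be touched: no piece is positive
    there, and it lies at distance \<open>R\<close> because \<open>dir 0\<close> is a unit vector
    and \<open>depth 0 = R\<close>.\<close>
  define xs where "xs = pos 0 R"
  have g_flat: "g (Suc N) \<bullet> v = 0" if "v \<in> carrier_vec (Suc N)" for v
    using that by (simp add: g_def slope_def)
  have env_nonneg: "0 \<le> envelope y" if "y \<in> carrier_vec (Suc N)" for y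
    using envelope_ge_piece[of "Suc N" y] that g_flat[of y] g_flat[of "g (Suc N)"]
    by (simp add: piece_def offset_def slope_def g)
  have "active (Suc N) xs"
    unfolding active_def
  proof (intro allI impI)
    fix j assume j: "j \<le> Suc N"
    have "piece j xs \<le> piece 0 xs" using piece_le[of 0 j R] j R by (simp add: xs_def)
    also have "piece 0 xs = 0" by (simp add: xs_def piece_pos height_same)
    finally show "piece j xs - g j \<bullet> g (Suc N) / L \<le> piece (Suc N) xs - g (Suc N) \<bullet> g (Suc N) / L"
      using g_flat[OF g] comm_scalar_prod[OF g g, of j "Suc N"]
      by (simp add: xs_def piece_pos slope_def)
  qed
  then have env_xs: "envelope xs = 0"
    by (subst envelope_active[of "Suc N"]) (auto simp: g_flat g xs_def piece_pos slope_def)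
  have xs: "xs \<in> argmin_Rd (Suc N) envelope"
    using env_nonneg env_xs by (simp add: argmin_Rd_def xs_def)
  have "x0 - xs = R \<cdot>\<^sub>v unit_vec (Suc N) 0"
    using x0 by (intro eq_vecI) (auto simp: xs_def pos_def lincomb_dir_def path_def unit_vec_def)
  then have norm: "vnorm (x0 - xs) = R"
    using R by (simp add: vnorm_def)
  \<comment> \<open>The halved last slope leaves half the depth even at the proximal point of the
    last iterate.\<close>
  have "depth N / 2 \<le> height N N (\<theta> T + slope N / L)"
  proof -
    have half: "depth N / 2 \<le> depth N - (\<theta> T + slope N / L)"
      using \<theta>(2)[of T] \<omega>[of N] by (simp add: \<iota>_T slope_def)
    also have "\<dots> \<le> (1 + (tilt N)\<^sup>2) * (depth N - (\<theta> T + slope N / L))"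
      using half depth_nonneg[of N] mult_right_mono[of 1 "1 + (tilt N)\<^sup>2" "depth N - (\<theta> T + slope N / L)"]
      by simp
    finally show ?thesis unfolding height_same[OF order_refl] .
  qed
  then have "slope N * (depth N / 2) \<le> slope N * height N N (\<theta> T + slope N / L)"
    using slope_nonneg by (rule mult_left_mono)
  also have "\<dots> = piece N (x T) - (g N \<bullet> g N) / L"
    using prox[of N N "\<theta> T"] by (simp add: x_def \<iota>_T piece_pos)
  also have "\<dots> \<le> piece N (x T) - (g N \<bullet> g N) / (2 * L)"
    using L scalar_prod_self_nonneg[of "g N"] by (simp add: field_simps)
  also have "\<dots> \<le> envelope (x T)" by (rule envelope_ge_piece) simp
  finally have "(depth N)\<^sup>2 / (4 * \<omega> N) \<le> envelope (x T)"
    by (simp add: slope_def power2_eq_square)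
  then show ?thesis
    using envelope_F0L[OF xs] xs norm gd env_xs by (intro bexI[of _ envelope] bexI[of _ xs]) auto
qed

end

section \<open>Choice of the overshooting steps\<close>

lemma weighted_sum_nonneg:
  fixes w e :: "nat \<Rightarrow> real"
  assumes w: "\<And>k. k < n \<Longrightarrow> 0 \<le> w k" "\<And>k. Suc k < n \<Longrightarrow> w (Suc k) \<le> w k"
    and e: "\<And>k. k \<le> n \<Longrightarrow> 0 \<le> (\<Sum>l<k. e l)"
  shows "0 \<le> (\<Sum>l<n. w l * e l)"
proof (cases n)
  case (Suc m)
  \<comment> \<open>Abel summation as an induction: lowering the weight of a nonnegative prefix sum
    only decreases the left side.\<close>
  have "w k * (\<Sum>l<Suc k. e l) \<le> (\<Sum>l<Suc k. w l * e l)" if "k < n" for k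
    using that
  proof (induction k)
    case (Suc k)
    have "w (Suc k) * (\<Sum>l<Suc k. e l) \<le> w k * (\<Sum>l<Suc k. e l)"
      using Suc.prems w(2) e[of "Suc k"] by (intro mult_right_mono) auto
    also have "\<dots> \<le> (\<Sum>l<Suc k. w l * e l)" using Suc by simp
    finally show ?case by (simp add: distrib_left)
  qed simp
  from this[of m] show ?thesis
    using Suc w(1)[of m] e[of n] by (metis lessI mult_nonneg_nonneg order_refl order_trans)
qed simp

text \<open>From \<open>u \<le> exp (u - 1)\<close>; a form of the arithmetic-geometric mean
  inequality for factors with average near one.\<close>

lemma prod_le_exp_sum:
  fixes f :: "'a \<Rightarrow> real"
  assumes "\<And>x. x \<in> A \<Longrightarrow> 0 \<le> f x"
  shows "prod f A \<le> exp (\<Sum>x\<in>A. f x - 1)"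
proof (cases "finite A")
  case True
  have "prod f A \<le> (\<Prod>x\<in>A. exp (f x - 1))"
    using assms exp_ge_add_one_self[of "f _ - 1"] by (intro prod_mono) auto
  then show ?thesis using True by (simp add: exp_sum)
qed simp

text \<open>The product of the quotients \<open>q l / s l\<close> is at most the exponential of the
  sum of \<open>q l / s l - 1\<close>, which Abel summation with the decreasing weights
  \<open>1 / s l\<close> shows to be nonpositive.\<close>

lemma prod_le_prod_if_prefix_sums_le:
  fixes s q :: "nat \<Rightarrow> real"
  assumes s: "\<And>k. k < n \<Longrightarrow> 0 < s k" "\<And>k. Suc k < n \<Longrightarrow> s k \<le> s (Suc k)"
    and q: "\<And>k. k < n \<Longrightarrow> 0 \<le> q k"
    and le: "\<And>k. k \<le> n \<Longrightarrow> (\<Sum>l<k. q l) \<le> (\<Sum>l<k. s l)"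
  shows "(\<Prod>l<n. q l) \<le> (\<Prod>l<n. s l)"
proof -
  have "0 \<le> (\<Sum>l<n. 1 / s l * (s l - q l))"
  proof (rule weighted_sum_nonneg)
    show "1 / s (Suc k) \<le> 1 / s k" if "Suc k < n" for k
      using s that by (intro divide_left_mono mult_pos_pos) auto
  qed (use s le in \<open>auto simp: sum_subtractf less_imp_le\<close>)
  also have "(\<Sum>l<n. 1 / s l * (s l - q l)) = - (\<Sum>l<n. q l / s l - 1)"
    unfolding sum_negf[symmetric]
  proof (rule sum.cong)
    show "1 / s l * (s l - q l) = - (q l / s l - 1)" if "l \<in> {..<n}" for l
      using s(1)[of l] that by (simp add: field_simps)
  qed simp
  finally have "(\<Sum>l<n. q l / s l - 1) \<le> 0" by simp
  moreover have "(\<Prod>l<n. q l / s l) \<le> exp (\<Sum>l<n. q l / s l - 1)"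
    using s(1) q by (intro prod_le_exp_sum) (simp add: less_imp_le)
  ultimately have "(\<Prod>l<n. q l / s l) \<le> 1"
    by (meson exp_le_one_iff order_trans)
  moreover have "0 < (\<Prod>l<n. s l)" using s(1) by (intro prod_pos) auto
  ultimately show ?thesis by (simp add: prod_dividef)
qed

text \<open>List \<open>A\<close> by increasing \<open>f\<close>: every prefix is a subset of
  \<open>A\<close>, so the prefix-sum version applies.\<close>

lemma prod_le_prod_if_subset_sums_ge:
  fixes f :: "nat \<Rightarrow> real" and q :: "nat \<Rightarrow> real"
  assumes fin: "finite A" and f: "\<And>a. a \<in> A \<Longrightarrow> 0 < f a"
    and q: "\<And>k. k < card A \<Longrightarrow> 0 \<le> q k"
    and le: "\<And>B. B \<subseteq> A \<Longrightarrow> (\<Sum>l<card B. q l) \<le> sum f B"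
  shows "(\<Prod>l<card A. q l) \<le> prod f A"
proof -
  define xs where "xs = sort_key f (sorted_list_of_set A)"
  have set: "set xs = A" and dist: "distinct xs" and sorted: "sorted (map f xs)"
    using fin by (auto simp: xs_def)
  have len: "length xs = card A" using dist set distinct_card by metis
  have bij: "bij_betw (\<lambda>l. xs ! l) {..<k} (set (take k xs))" if "k \<le> length xs" for k
  proof -
    have "bij_betw (\<lambda>l. take k xs ! l) {..<k} (set (take k xs))"
      using that dist by (intro bij_betw_nth) (auto simp: min_def)
    then show ?thesis by (subst (asm) bij_betw_cong[where g = "\<lambda>l. xs ! l"]) auto
  qed
  have "(\<Prod>l<card A. q l) \<le> (\<Prod>l<card A. f (xs ! l))"
  proof (rule prod_le_prod_if_prefix_sums_le)
    show "0 < f (xs ! k)" if "k < card A" for k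
      using that f set len nth_mem by metis
    show "f (xs ! k) \<le> f (xs ! Suc k)" if "Suc k < card A" for k
      using sorted_nth_mono[OF sorted, of k "Suc k"] that len by simp
    show "(\<Sum>l<k. q l) \<le> (\<Sum>l<k. f (xs ! l))" if "k \<le> card A" for k
    proof -
      have B: "bij_betw (\<lambda>l. xs ! l) {..<k} (set (take k xs))" using bij that len by simp
      have "card (set (take k xs)) = k" using bij_betw_same_card[OF B] by simp
      moreover have "set (take k xs) \<subseteq> A" using set set_take_subset by metis
      ultimately show ?thesis using le sum.reindex_bij_betw[OF B, of f] by metis
    qed
  qed (rule q)
  also have "\<dots> = prod f A"
    using prod.reindex_bij_betw[OF bij[of "card A"], of f] len set by simp
  finally show ?thesis .
qed

lemma inverse_le_ln_quotient:
  fixes m :: real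
  assumes "1 < m"
  shows "1 / m \<le> ln (m / (m - 1))"
proof -
  have "ln ((m - 1) / m) \<le> (m - 1) / m - 1" using assms by (intro ln_le_minus_one) auto
  also have "(m - 1) / m - 1 = - (1 / m)" using assms by (simp add: field_simps)
  finally show ?thesis using assms by (simp add: ln_div)
qed

text \<open>A bound of Stirling type; the induction rests on
  \<open>exp 1 \<le> ((m + 1) / m) ^ (m + 1)\<close> for \<open>m = Suc n\<close>.\<close>

lemma exp_mult_fact_le: "exp (real n) * fact (Suc n) \<le> real (Suc n) ^ (n + 2)"
proof (induction n)
  case (Suc n)
  define m where "m = real (Suc n)"
  have m: "0 < m" by (simp add: m_def)
  have "1 / (m + 1) \<le> ln ((m + 1) / m)"
    using inverse_le_ln_quotient[of "m + 1"] m by simp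
  then have "exp 1 \<le> exp (real (n + 2) * ln ((m + 1) / m))"
    using m by (simp add: m_def field_simps)
  also have "\<dots> = ((m + 1) / m) ^ (n + 2)"
    using m by (simp only: exp_of_nat_mult) simp
  finally have "exp 1 \<le> ((m + 1) / m) ^ (n + 2)" .
  then have "exp 1 * m ^ (n + 2) \<le> (m + 1) ^ (n + 2)"
    using m by (simp add: power_divide field_simps)
  moreover have "exp (real n) * fact (Suc n) * exp 1 \<le> m ^ (n + 2) * exp 1"
    using Suc unfolding m_def by (intro mult_right_mono) auto
  ultimately have "exp (real n) * exp 1 * fact (Suc n) \<le> (m + 1) ^ (n + 2)"
    by (simp only: mult_ac)
  then have "(m + 1) * (exp (real n) * exp 1 * fact (Suc n)) \<le> (m + 1) * (m + 1) ^ (n + 2)"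
    using m by (intro mult_left_mono) auto
  moreover have "exp (real (Suc n)) = exp (real n) * exp 1" by (simp add: exp_add)
  ultimately show ?case by (simp add: m_def mult_ac)
qed simp

text \<open>A tangent bound: \<open>(M / u) powr b\<close> is convex in \<open>u\<close>, and the
  left side is minus its derivative at \<open>m\<close>.\<close>

lemma powr_increment_ge:
  fixes b m M :: real
  assumes b: "0 \<le> b" and m: "1 < m" and M: "0 < M"
  shows "b / M * (M / m) powr (1 + b) \<le> (M / (m - 1)) powr b - (M / m) powr b"
proof -
  have "1 / m \<le> ln (m / (m - 1))" by (rule inverse_le_ln_quotient[OF m])
  then have "1 + b / m \<le> 1 + b * ln (m / (m - 1))"
    using mult_left_mono[OF _ b] by fastforce
  also have "\<dots> \<le> (m / (m - 1)) powr b"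
    using m exp_ge_add_one_self[of "b * ln (m / (m - 1))"] by (simp add: powr_def)
  finally have "(M / m) powr b * (1 + b / m) \<le> (M / m) powr b * (m / (m - 1)) powr b"
    by (intro mult_left_mono) auto
  also have "\<dots> = (M / (m - 1)) powr b"
    using m M by (simp flip: powr_mult)
  finally have "(M / m) powr b * (b / m) \<le> (M / (m - 1)) powr b - (M / m) powr b"
    by (simp add: distrib_left)
  moreover have "b / M * (M / m) powr (1 + b) = (M / m) powr b * (b / m)"
    using m M by (simp add: powr_add)
  ultimately show ?thesis by simp
qed

lemma prod_quotient_descending:
  "(\<Prod>k<N. c / real (Suc N - k)) = c ^ N / fact (Suc N)"
proof -
  have "(\<Prod>k<N. real (Suc N - k)) = (\<Prod>k<N. real (k + 2))"
    by (subst prod.nat_diff_reindex[symmetric]) (intro prod.cong, auto)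
  also have "\<dots> = fact (Suc N)"
    by (induction N) (auto simp: algebra_simps)
  finally show ?thesis by (simp add: prod_dividef)
qed

text \<open>The product is the reciprocal of the decay of the squared depth. The
  \<open>\<sigma> \<tau>\<close> are bounded below by a power law and the
  \<open>\<omega> \<tau>\<close> above by their mean, which leaves a geometric term times a
  polynomial.\<close>

lemma product_bound:
  fixes \<omega> \<sigma> :: "nat \<Rightarrow> real" and b Z :: real and C :: "nat set"
  defines "N \<equiv> card C"
  defines "M \<equiv> real (Suc N)"
  assumes fin: "finite C" and b: "0 < b" "b \<le> 1" and Z: "0 < Z"
    and \<omega>: "\<And>\<tau>. \<tau> \<in> C \<Longrightarrow> 0 < \<omega> \<tau>" and \<omega>_sum: "(\<Sum>\<tau>\<in>C. \<omega> \<tau>) \<le> Z"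
    and subset: "\<And>B. B \<subseteq> C \<Longrightarrow> Z * ((M / (M - card B)) powr b - 1) \<le> sum \<sigma> B"
  shows "\<And>\<tau>. \<tau> \<in> C \<Longrightarrow> 0 < \<sigma> \<tau>"
    and "(\<Prod>\<tau>\<in>C. (\<sigma> \<tau> / \<omega> \<tau> + 4) / (\<sigma> \<tau> / \<omega> \<tau>)\<^sup>2)
      \<le> exp 2 * M ^ 4 * ((b + 4) / (b\<^sup>2 * exp (1 + b))) ^ N"
proof -
  have M: "0 < M" by (simp add: M_def)
  have \<sigma>_ge: "b * Z / M \<le> \<sigma> \<tau>" if "\<tau> \<in> C" for \<tau>
  proof -
    have "0 < N" using that fin by (auto simp: N_def card_gt_0_iff)
    then have "1 < M" by (simp add: M_def)
    have "b / M \<le> (M / (M - 1)) powr b - 1"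
      using powr_increment_ge[of b M M] b \<open>1 < M\<close> by simp
    then have "Z * (b / M) \<le> Z * ((M / (M - 1)) powr b - 1)"
      using Z by (intro mult_left_mono) auto
    then show ?thesis using subset[of "{\<tau>}"] that by (simp add: mult_ac)
  qed
  show \<sigma>_pos: "0 < \<sigma> \<tau>" if "\<tau> \<in> C" for \<tau>
    using \<sigma>_ge[OF that] b Z M by (meson divide_pos_pos less_le_trans mult_pos_pos)
  \<comment> \<open>A lower bound for the increment of \<open>Z * (M / (M - k)) powr b\<close> from
    \<open>k\<close> to \<open>k + 1\<close>, so the sums telescope.\<close>
  define q where "q k = b * Z / M * (M / (M - real k)) powr (1 + b)" for k
  have "(\<Prod>k<N. q k) \<le> prod \<sigma> C"
    unfolding N_def
  proof (rule prod_le_prod_if_subset_sums_ge[OF fin])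
    show "0 < \<sigma> \<tau>" if "\<tau> \<in> C" for \<tau> by (rule \<sigma>_pos[OF that])
    show "0 \<le> q k" for k unfolding q_def using b Z M by simp
    show "(\<Sum>l<card B. q l) \<le> sum \<sigma> B" if "B \<subseteq> C" for B
    proof -
      have "(\<Sum>l<k. q l) \<le> Z * ((M / (M - real k)) powr b - 1)" if "k \<le> N" for k
        using that
      proof (induction k)
        case (Suc k)
        then have "1 < M - real k" by (simp add: M_def)
        then have "b / M * (M / (M - real k)) powr (1 + b)
            \<le> (M / (M - real (Suc k))) powr b - (M / (M - real k)) powr b"
          using powr_increment_ge[of b "M - real k" M] b M by (simp add: diff_diff_eq add.commute)
        then have "q k \<le> Z * ((M / (M - real (Suc k))) powr b - (M / (M - real k)) powr b)"
          using mult_left_mono[OF _ less_imp_le[OF Z]] by (fastforce simp: q_def mult_ac)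
        then show ?case using Suc by (simp add: algebra_simps)
      qed (use M in simp)
      from this[of "card B"] show ?thesis
        using subset[OF that] card_mono[OF fin that] by (simp add: N_def)
    qed
  qed
  moreover have "(b * Z / M) ^ N * (exp (real N) / M\<^sup>2) powr (1 + b) \<le> (\<Prod>k<N. q k)"
  proof -
    have "exp (real N) * fact (Suc N) \<le> M ^ N * M\<^sup>2"
      using exp_mult_fact_le[of N] unfolding M_def power_add .
    then have "exp (real N) / M\<^sup>2 \<le> M ^ N / fact (Suc N)"
      using M by (simp add: divide_le_eq le_divide_eq mult_ac)
    also have "\<dots> = (\<Prod>k<N. M / (M - real k))"
      unfolding prod_quotient_descending[symmetric] by (intro prod.cong) (auto simp: M_def of_nat_diff)
    finally have "(exp (real N) / M\<^sup>2) powr (1 + b) \<le> (\<Prod>k<N. M / (M - real k)) powr (1 + b)"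
      using b by (intro powr_mono2) auto
    also have "\<dots> = (\<Prod>k<N. (M / (M - real k)) powr (1 + b))"
      by (rule prod_powr_distrib)
    finally show ?thesis
      unfolding q_def prod.distrib using b Z M by (simp add: mult_left_mono)
  qed
  ultimately have \<sigma>_prod: "(b * Z / M) ^ N * (exp (real N) / M\<^sup>2) powr (1 + b) \<le> prod \<sigma> C"
    by simp

  \<comment> \<open>Normalised to a total of at most \<open>M = N + 1\<close>, one more than the
    number of factors.\<close>
  define v where "v \<tau> = M / Z * \<omega> \<tau>" for \<tau>
  have v: "0 < v \<tau>" if "\<tau> \<in> C" for \<tau> using \<omega>[OF that] Z M by (simp add: v_def)
  have v_sum: "(\<Sum>\<tau>\<in>C. v \<tau> - 1) \<le> 1"
  proof -
    have "(\<Sum>\<tau>\<in>C. v \<tau>) = M / Z * (\<Sum>\<tau>\<in>C. \<omega> \<tau>)" by (simp add: v_def sum_distrib_left)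
    also have "\<dots> \<le> M / Z * Z" using \<omega>_sum Z M by (intro mult_left_mono) auto
    finally show ?thesis using Z by (simp add: sum_subtractf M_def N_def)
  qed
  have prod_v: "prod v C \<le> exp 1"
    using prod_le_exp_sum[of C v] v v_sum by (meson exp_le_cancel_iff less_imp_le order_trans)
  have prod_w: "(\<Prod>\<tau>\<in>C. 1 + 4 / b * v \<tau>) \<le> (1 + 4 / b) ^ N * exp 1"
  proof -
    \<comment> \<open>Divided by \<open>1 + a\<close>, each factor is a convex combination of
      \<open>1\<close> and \<open>v \<tau>\<close>, so its excess over one shrinks by
      \<open>r\<close>.\<close>
    define a where "a = 4 / b"
    define r where "r = a / (1 + a)"
    have a: "0 < a" using b by (simp add: a_def)
    then have r: "0 \<le> r" "r \<le> 1" by (auto simp: r_def)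
    have eq: "(1 + 4 / b * u) / (1 + 4 / b) - 1 = r * (u - 1)" for u
      unfolding a_def[symmetric] r_def using a by (simp add: field_simps)
    have "(\<Prod>\<tau>\<in>C. (1 + 4 / b * v \<tau>) / (1 + 4 / b)) \<le> exp (\<Sum>\<tau>\<in>C. (1 + 4 / b * v \<tau>) / (1 + 4 / b) - 1)"
      using v b by (intro prod_le_exp_sum) (simp add: less_imp_le)
    also have "(\<Sum>\<tau>\<in>C. (1 + 4 / b * v \<tau>) / (1 + 4 / b) - 1) = r * (\<Sum>\<tau>\<in>C. v \<tau> - 1)"
      unfolding eq by (simp add: sum_distrib_left)
    also have "exp (r * (\<Sum>\<tau>\<in>C. v \<tau> - 1)) \<le> exp 1"
    proof -
      have "r * (\<Sum>\<tau>\<in>C. v \<tau> - 1) \<le> r * 1" using v_sum r by (intro mult_left_mono)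
      then show ?thesis using r by simp
    qed
    finally have "(\<Prod>\<tau>\<in>C. 1 + 4 / b * v \<tau>) / (1 + 4 / b) ^ N \<le> exp 1"
      by (simp add: prod_dividef N_def)
    moreover have "0 < (1 + 4 / b) ^ N" using b by (simp add: add_pos_pos)
    ultimately show ?thesis by (simp add: pos_divide_le_eq mult_ac)
  qed
  have term_le: "(\<sigma> \<tau> / \<omega> \<tau> + 4) / (\<sigma> \<tau> / \<omega> \<tau>)\<^sup>2 \<le> (1 + 4 / b * v \<tau>) * (v \<tau> * ((Z / M) / \<sigma> \<tau>))"
    if "\<tau> \<in> C" for \<tau>
  proof -
    note pos = \<sigma>_pos[OF that] \<omega>[OF that]
    have eq: "(\<sigma> \<tau> / \<omega> \<tau> + 4) / (\<sigma> \<tau> / \<omega> \<tau>)\<^sup>2 = (1 + 4 * (\<omega> \<tau> / \<sigma> \<tau>)) * (\<omega> \<tau> / \<sigma> \<tau>)"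
      using pos by (simp add: field_simps power2_eq_square)
    have y: "\<omega> \<tau> / \<sigma> \<tau> = v \<tau> * ((Z / M) / \<sigma> \<tau>)" using Z M by (simp add: v_def)
    \<comment> \<open>The crude bound from singletons enters only the factor containing the
      \<open>4\<close>; the other factor keeps \<open>\<sigma> \<tau>\<close> for the product
      estimate.\<close>
    have "(Z / M) / \<sigma> \<tau> \<le> 1 / b"
      using \<sigma>_ge[OF that] pos b M by (simp add: field_simps)
    then have "v \<tau> * ((Z / M) / \<sigma> \<tau>) \<le> v \<tau> * (1 / b)"
      using v[OF that] by (intro mult_left_mono) auto
    then have "1 + 4 * (\<omega> \<tau> / \<sigma> \<tau>) \<le> 1 + 4 / b * v \<tau>" unfolding y by simp
    then have "(1 + 4 * (\<omega> \<tau> / \<sigma> \<tau>)) * (\<omega> \<tau> / \<sigma> \<tau>) \<le> (1 + 4 / b * v \<tau>) * (\<omega> \<tau> / \<sigma> \<tau>)"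
      using pos by (intro mult_right_mono) auto
    then show ?thesis unfolding eq y .
  qed
  define S where "S = (b * Z / M) ^ N * (exp (real N) / M\<^sup>2) powr (1 + b)"
  have S: "0 < S" using b Z M by (simp add: S_def)
  have "(\<Prod>\<tau>\<in>C. (\<sigma> \<tau> / \<omega> \<tau> + 4) / (\<sigma> \<tau> / \<omega> \<tau>)\<^sup>2)
      \<le> (\<Prod>\<tau>\<in>C. (1 + 4 / b * v \<tau>) * (v \<tau> * ((Z / M) / \<sigma> \<tau>)))"
  proof (intro prod_mono conjI)
    show "0 \<le> (\<sigma> \<tau> / \<omega> \<tau> + 4) / (\<sigma> \<tau> / \<omega> \<tau>)\<^sup>2" if "\<tau> \<in> C" for \<tau>
      using \<sigma>_pos[OF that] \<omega>[OF that] by (simp add: add_nonneg_nonneg)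
  qed (rule term_le)
  also have "\<dots> = (\<Prod>\<tau>\<in>C. 1 + 4 / b * v \<tau>) * (prod v C * ((Z / M) ^ N / prod \<sigma> C))"
    by (simp add: prod.distrib prod_dividef power_divide N_def)
  also have "\<dots> \<le> ((1 + 4 / b) ^ N * exp 1) * (exp 1 * ((Z / M) ^ N / S))"
  proof (intro mult_mono prod_w prod_v)
    show "(Z / M) ^ N / prod \<sigma> C \<le> (Z / M) ^ N / S"
      using \<sigma>_prod S Z M by (intro divide_left_mono) (auto simp: S_def[symmetric])
    show "0 \<le> (Z / M) ^ N / prod \<sigma> C" "0 \<le> prod v C * ((Z / M) ^ N / prod \<sigma> C)"
      using Z M v \<sigma>_pos by (simp_all add: prod_nonneg less_imp_le)
  qed (use b in auto)
  also have "\<dots> = exp 2 * ((1 + 4 / b) ^ N / (b ^ N * (exp (real N) / M\<^sup>2) powr (1 + b)))"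
  proof -
    have e: "exp 2 = exp 1 * exp (1::real)" by (simp flip: exp_add)
    have "(b * Z / M) ^ N = b ^ N * (Z / M) ^ N" by (simp add: power_mult_distrib power_divide)
    then show ?thesis unfolding S_def e using Z M by (simp add: field_simps)
  qed
  also have "(exp (real N) / M\<^sup>2) powr (1 + b) = exp (1 + b) ^ N / (M\<^sup>2) powr (1 + b)"
  proof -
    have "exp (real N) powr (1 + b) = exp (1 + b) ^ N"
      by (simp add: powr_def mult.commute flip: exp_of_nat_mult)
    then show ?thesis by (simp add: powr_divide)
  qed
  also have "exp 2 * ((1 + 4 / b) ^ N / (b ^ N * (exp (1 + b) ^ N / (M\<^sup>2) powr (1 + b))))
      = exp 2 * (M\<^sup>2) powr (1 + b) * ((b + 4) / (b\<^sup>2 * exp (1 + b))) ^ N"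
  proof -
    have "(b + 4) / (b\<^sup>2 * exp (1 + b)) = (1 + 4 / b) / (b * exp (1 + b))"
      using b by (simp add: field_simps power2_eq_square)
    then show ?thesis using M by (simp add: power_divide power_mult_distrib)
  qed
  also have "\<dots> \<le> exp 2 * M ^ 4 * ((b + 4) / (b\<^sup>2 * exp (1 + b))) ^ N"
  proof -
    have "(M\<^sup>2) powr (1 + b) \<le> (M\<^sup>2) powr 2"
      using b by (intro powr_mono) (auto simp: M_def)
    also have "\<dots> = M ^ 4" using M by (simp add: powr_numeral flip: power_mult)
    finally show ?thesis using b by (intro mult_right_mono mult_left_mono) auto
  qed
  finally show "(\<Prod>\<tau>\<in>C. (\<sigma> \<tau> / \<omega> \<tau> + 4) / (\<sigma> \<tau> / \<omega> \<tau>)\<^sup>2)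
      \<le> exp 2 * M ^ 4 * ((b + 4) / (b\<^sup>2 * exp (1 + b))) ^ N" .
qed

section \<open>Selecting the long steps and assembling the instance\<close>

lemma exists_balanced_subset:
  fixes \<eta> :: "nat \<Rightarrow> real" and b \<epsilon> :: real
  assumes b: "0 \<le> b" and \<epsilon>: "0 < \<epsilon>" and \<eta>: "\<And>t. t < T \<Longrightarrow> 0 \<le> \<eta> t"
  obtains C where "C \<subseteq> {..<T}"
    and "(\<Sum>t\<in>{..<T} - C. \<eta> t) + \<epsilon> * Suc (card C) \<le> \<epsilon> * (real T + 1) powr (1 + b)"
    and "\<And>B. B \<subseteq> C \<Longrightarrow>
      ((\<Sum>t\<in>{..<T} - C. \<eta> t) + \<epsilon> * Suc (card C)) *
        ((Suc (card C) / (real (Suc (card C)) - card B)) powr b - 1) \<le> (\<Sum>t\<in>B. \<eta> t - \<epsilon>)"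
proof -
  define Z where "Z = (\<lambda>C. (\<Sum>t\<in>{..<T} - C. \<eta> t) + \<epsilon> * Suc (card C))"
  define F where "F = (\<lambda>C. Z C * real (Suc (card C)) powr b)"
  \<comment> \<open>Comparing the minimiser with the set of all steps bounds \<open>Z C\<close>;
    comparing it with \<open>C - B\<close> gives the condition on \<open>B\<close>.\<close>
  obtain C where C: "is_arg_min F (\<lambda>C. C \<in> Pow {..<T}) C"
    using ex_is_arg_min_if_finite[of "Pow {..<T}" F] by auto
  then have sub: "C \<subseteq> {..<T}" and min: "\<And>C'. C' \<subseteq> {..<T} \<Longrightarrow> F C \<le> F C'"
    by (auto simp: is_arg_min_def not_less)
  have fin: "finite C" using sub finite_subset by blast
  define M where "M = real (Suc (card C))"
  have M: "1 \<le> M" by (simp add: M_def)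
  have Z0: "0 \<le> Z C" unfolding Z_def using \<eta> \<epsilon> by (intro add_nonneg_nonneg sum_nonneg) auto
  have "Z C * 1 \<le> Z C * M powr b"
    using Z0 M b by (intro mult_left_mono ge_one_powr_ge_zero) auto
  also have "\<dots> = F C" by (simp add: F_def M_def)
  also have "\<dots> \<le> F {..<T}" by (rule min) simp
  also have "\<dots> = \<epsilon> * (real T + 1) powr (1 + b)"
    by (simp add: F_def Z_def powr_add add.commute)
  finally have bound: "Z C \<le> \<epsilon> * (real T + 1) powr (1 + b)" by simp
  have "Z C * ((M / (M - real (card B))) powr b - 1) \<le> (\<Sum>t\<in>B. \<eta> t - \<epsilon>)" if B: "B \<subseteq> C" for B
  proof -
    have finB: "finite B" and le: "card B \<le> card C" using B fin finite_subset card_mono by auto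
    define m where "m = M - real (card B)"
    have m: "1 \<le> m" using le by (simp add: m_def M_def)
    have card: "real (Suc (card (C - B))) = m"
      using le by (simp add: card_Diff_subset[OF finB B] m_def M_def of_nat_diff)
    have "{..<T} - (C - B) = ({..<T} - C) \<union> B" using B sub by auto
    then have "(\<Sum>t\<in>{..<T} - (C - B). \<eta> t) = (\<Sum>t\<in>{..<T} - C. \<eta> t) + sum \<eta> B"
      using finB B by (auto simp: sum.union_disjoint[symmetric] intro!: sum.union_disjoint)
    then have "Z (C - B) = Z C + (\<Sum>t\<in>B. \<eta> t - \<epsilon>)"
      unfolding Z_def card by (simp add: sum_subtractf m_def M_def algebra_simps)
    moreover have "Z C * M powr b \<le> Z (C - B) * m powr b"
      using min[of "C - B"] sub unfolding F_def card by (auto simp: M_def)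
    then have "Z C * (M powr b / m powr b) \<le> Z (C - B)"
      using m by (simp add: pos_divide_le_eq)
    moreover have "(M / m) powr b = M powr b / m powr b"
      using m M by (simp add: powr_divide)
    ultimately show ?thesis
      unfolding m_def[symmetric] by (simp add: right_diff_distrib)
  qed
  with sub bound show ?thesis by (intro that[of C]) (auto simp: Z_def M_def)
qed

text \<open>The count is strictly increasing on \<open>C\<close>, and an injection between finite
  sets of equal size is onto.\<close>

lemma bij_betw_card_below:
  fixes C :: "nat set"
  assumes fin: "finite C"
  shows "bij_betw (\<lambda>t. card {\<tau>\<in>C. \<tau> < t}) C {..<card C}"
proof -
  have less: "card {\<tau>\<in>C. \<tau> < t} < card B" if "t \<in> B" "{\<tau>\<in>C. \<tau> < t} \<subseteq> B" "B \<subseteq> C" for t B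
  proof (rule psubset_card_mono[OF finite_subset[OF that(3) fin] psubsetI[OF that(2)]])
    have "t \<notin> {\<tau>\<in>C. \<tau> < t}" by simp
    with that(1) show "{\<tau>\<in>C. \<tau> < t} \<noteq> B" by blast
  qed
  have "card {\<tau>\<in>C. \<tau> < t} < card {\<tau>\<in>C. \<tau> < t'}" if "t \<in> C" "t < t'" for t t'
    using that by (intro less[of t "{\<tau>\<in>C. \<tau> < t'}"]) auto
  then have "strict_mono_on C (\<lambda>t. card {\<tau>\<in>C. \<tau> < t})" by (intro strict_mono_onI)
  then have inj: "inj_on (\<lambda>t. card {\<tau>\<in>C. \<tau> < t}) C" by (rule strict_mono_on_imp_inj_on)
  moreover have "(\<lambda>t. card {\<tau>\<in>C. \<tau> < t}) ` C \<subseteq> {..<card C}"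
    using less[of _ C] by blast
  ultimately have "(\<lambda>t. card {\<tau>\<in>C. \<tau> < t}) ` C = {..<card C}"
    by (intro card_subset_eq) (auto simp: card_image)
  with inj show ?thesis by (simp add: bij_betw_def)
qed

lemma hard_instance:
  fixes \<eta> :: "nat \<Rightarrow> real" and b L R :: real
  assumes b: "0 < b" "b \<le> 1" and L: "0 < L" and R: "0 < R" and \<eta>: "\<And>t. t < T \<Longrightarrow> 0 \<le> \<eta> t"
  obtains N where "N \<le> T"
    and "\<And>x0. x0 \<in> carrier_vec (Suc N) \<Longrightarrow>
      \<exists>f\<in>F0L L (Suc N). \<exists>xs\<in>argmin_Rd (Suc N) f. vnorm (x0 - xs) = R \<and>
        L * R\<^sup>2 / (16 * (exp 2 * real (Suc N) ^ 4 * ((b + 4) / (b\<^sup>2 * exp (1 + b))) ^ N)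
          * (real T + 1) powr (1 + b)) \<le> f (gd_iter (Suc N) f \<eta> x0 T) - f xs"
proof -
  define \<epsilon> where "\<epsilon> = 1 / L"
  have \<epsilon>: "0 < \<epsilon>" using L by (simp add: \<epsilon>_def)
  obtain C where C: "C \<subseteq> {..<T}"
    and Z_le: "(\<Sum>t\<in>{..<T} - C. \<eta> t) + \<epsilon> * Suc (card C) \<le> \<epsilon> * (real T + 1) powr (1 + b)"
    and subset: "\<And>B. B \<subseteq> C \<Longrightarrow>
      ((\<Sum>t\<in>{..<T} - C. \<eta> t) + \<epsilon> * Suc (card C)) *
        ((Suc (card C) / (real (Suc (card C)) - card B)) powr b - 1) \<le> (\<Sum>t\<in>B. \<eta> t - \<epsilon>)"
    using exists_balanced_subset[of b \<epsilon> T \<eta>] b \<epsilon> \<eta> by (metis less_imp_le)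
  define N where "N = card C"
  define Z where "Z = (\<Sum>t\<in>{..<T} - C. \<eta> t) + \<epsilon> * Suc N"
  have fin: "finite C" using C finite_subset by blast
  have NT: "N \<le> T" using card_mono[OF _ C] by (simp add: N_def)
  have Z: "0 < Z" unfolding Z_def using \<eta> \<epsilon> by (intro add_nonneg_pos sum_nonneg) auto

  \<comment> \<open>The comparison is strict, so a long step belongs to the window that it
    ends.\<close>
  define \<iota> where "\<iota> t = card {\<tau>\<in>C. \<tau> < t}" for t
  have bij: "bij_betw \<iota> C {..<N}"
    using bij_betw_card_below[OF fin] unfolding \<iota>_def N_def .
  have \<iota>_mono: "\<iota> t \<le> \<iota> t'" if "t \<le> t'" for t t'
    unfolding \<iota>_def using that fin by (intro card_mono) auto
  have \<iota>_le: "\<iota> t \<le> N" for t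
    unfolding \<iota>_def N_def using fin by (intro card_mono) auto
  have \<iota>_T: "\<iota> T = N"
    unfolding \<iota>_def N_def using C by (intro arg_cong[of _ _ card]) auto
  have \<iota>_strict: "\<iota> t < \<iota> t'" if "t \<in> C" "t < t'" for t t'
    unfolding \<iota>_def using that fin by (intro psubset_card_mono) auto

  define W where "W j = (\<Sum>t | t < T \<and> t \<notin> C \<and> \<iota> t = j. \<eta> t)" for j
  \<comment> \<open>The proximal allowance \<open>1 / L\<close> is moved from the long step to its
    window; the total length is unchanged.\<close>
  define \<omega> where "\<omega> j = W j + \<epsilon>" for j
  define \<sigma> where "\<sigma> j = (if j < N then \<eta> (inv_into C \<iota> j) - \<epsilon> else 0)" for j
  have W_nonneg: "0 \<le> W j" for j unfolding W_def using \<eta> by (intro sum_nonneg) auto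
  have \<omega>: "0 < \<omega> j" for j using W_nonneg[of j] \<epsilon> by (simp add: \<omega>_def)
  have \<sigma>_\<iota>: "\<sigma> (\<iota> t) = \<eta> t - \<epsilon>" if "t \<in> C" for t
    using that bij bij_betwE[OF bij] by (auto simp: \<sigma>_def bij_betw_def)
  have \<omega>_sum: "(\<Sum>j\<le>N. \<omega> j) = Z"
  proof -
    have "(\<Sum>j\<le>N. W j) = (\<Sum>j\<le>N. \<Sum>t\<in>{t\<in>{..<T} - C. \<iota> t = j}. \<eta> t)"
      unfolding W_def by (intro sum.cong refl) auto
    also have "\<dots> = (\<Sum>t\<in>{..<T} - C. \<eta> t)"
      using \<iota>_le by (intro sum.group) auto
    finally show ?thesis by (simp add: \<omega>_def sum.distrib Z_def mult.commute)
  qed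
  have \<omega>_sum_C: "(\<Sum>t\<in>C. \<omega> (\<iota> t)) \<le> Z"
  proof -
    have "(\<Sum>t\<in>C. \<omega> (\<iota> t)) = (\<Sum>j<N. \<omega> j)" by (rule sum.reindex_bij_betw[OF bij])
    also have "\<dots> \<le> (\<Sum>j\<le>N. \<omega> j)" using \<omega> by (intro sum_mono2) (auto intro: less_imp_le)
    finally show ?thesis using \<omega>_sum by simp
  qed
  define K where "K = exp 2 * real (Suc N) ^ 4 * ((b + 4) / (b\<^sup>2 * exp (1 + b))) ^ N"
  note pb = product_bound[OF fin b Z, of "\<lambda>t. \<omega> (\<iota> t)" "\<lambda>t. \<eta> t - \<epsilon>"]
  have \<sigma>_C: "0 < \<eta> t - \<epsilon>" if "t \<in> C" for t
    using pb(1) \<omega> \<omega>_sum_C subset that unfolding Z_def N_def by blast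
  have K: "(\<Prod>t\<in>C. ((\<eta> t - \<epsilon>) / \<omega> (\<iota> t) + 4) / ((\<eta> t - \<epsilon>) / \<omega> (\<iota> t))\<^sup>2) \<le> K"
    unfolding K_def N_def using pb(2) \<omega> \<omega>_sum_C subset unfolding Z_def N_def by blast

  interpret overshoot_chain N R \<omega> \<sigma>
  proof
    show "0 < \<sigma> j" if "j < N" for j
    proof -
      have "inv_into C \<iota> j \<in> C" using that bij by (simp add: bij_betw_def inv_into_into)
      then show ?thesis using \<sigma>_C that by (simp add: \<sigma>_def)
    qed
  qed (auto simp: R \<omega> \<sigma>_def)
  have ratio_pos: "0 < ratio j" if "j < N" for j
    using \<sigma>[OF that] \<omega>[of j] that by (simp add: ratio_def)

  have "(\<Prod>t\<in>C. ((\<eta> t - \<epsilon>) / \<omega> (\<iota> t) + 4) / ((\<eta> t - \<epsilon>) / \<omega> (\<iota> t))\<^sup>2)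
      = (\<Prod>t\<in>C. (ratio (\<iota> t) + 4) / (ratio (\<iota> t))\<^sup>2)"
    by (intro prod.cong) (auto simp: ratio_def \<sigma>_\<iota>)
  also have "\<dots> = (\<Prod>j<N. (ratio j + 4) / (ratio j)\<^sup>2)" by (rule prod.reindex_bij_betw[OF bij])
  also have "\<dots> = 1 / (\<Prod>j<N. (ratio j)\<^sup>2 / (ratio j + 4))" by (simp add: prod_dividef)
  finally have "1 / (\<Prod>j<N. (ratio j)\<^sup>2 / (ratio j + 4)) \<le> K" using K by simp
  moreover have P: "0 < (\<Prod>j<N. (ratio j)\<^sup>2 / (ratio j + 4))"
  proof (rule prod_pos)
    show "0 < (ratio j)\<^sup>2 / (ratio j + 4)" if "j \<in> {..<N}" for j
      using ratio_pos[of j] that by simp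
  qed
  moreover have "0 < K" unfolding K_def using b by (intro mult_pos_pos zero_less_power divide_pos_pos) auto
  ultimately have "1 / K \<le> (\<Prod>j<N. (ratio j)\<^sup>2 / (ratio j + 4))"
    by (simp add: divide_le_eq mult.commute)
  then have "R\<^sup>2 / 4 * (1 / K) \<le> R\<^sup>2 / 4 * (\<Prod>j<N. (ratio j)\<^sup>2 / (ratio j + 4))"
    by (intro mult_left_mono) auto
  then have depth: "R\<^sup>2 / (4 * K) \<le> (depth N)\<^sup>2" using depth_N_sq_ge by simp
  \<comment> \<open>Bounding the last window by the whole of \<open>Z\<close> is what produces the
    power of \<open>T + 1\<close> in the rate.\<close>
  have "\<omega> N \<le> (\<Sum>j\<le>N. \<omega> j)" using \<omega> by (intro member_le_sum) (auto intro: less_imp_le)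
  then have \<omega>_N: "\<omega> N \<le> (real T + 1) powr (1 + b) / L"
    using Z_le unfolding \<omega>_sum N_def[symmetric] Z_def[symmetric] by (simp add: \<epsilon>_def)
  have "L * R\<^sup>2 / (16 * K * (real T + 1) powr (1 + b)) = R\<^sup>2 / (4 * K) / (4 * ((real T + 1) powr (1 + b) / L))"
    by (simp add: mult_ac)
  also have "\<dots> \<le> (depth N)\<^sup>2 / (4 * \<omega> N)"
    using depth \<omega>_N \<omega>[of N] \<open>0 < K\<close> by (intro frac_le) auto
  finally have gap: "L * R\<^sup>2 / (16 * K * (real T + 1) powr (1 + b)) \<le> (depth N)\<^sup>2 / (4 * \<omega> N)" .

  have present: "0 \<le> (\<Sum>\<tau> | \<tau> < t \<and> \<iota> \<tau> = \<iota> t. \<eta> \<tau>) \<and> (\<Sum>\<tau> | \<tau> < t \<and> \<iota> \<tau> = \<iota> t. \<eta> \<tau>) + 1 / L \<le> \<omega> (\<iota> t)"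
    if t: "t \<le> T" for t
  proof -
    \<comment> \<open>A long step before \<open>t\<close> lies in an earlier window, so the current
      one contains only short steps so far.\<close>
    have "(\<Sum>\<tau> | \<tau> < t \<and> \<iota> \<tau> = \<iota> t. \<eta> \<tau>) \<le> W (\<iota> t)"
      unfolding W_def using t \<eta> \<iota>_strict[of _ t] by (intro sum_mono2) fastforce+
    moreover have "0 \<le> (\<Sum>\<tau> | \<tau> < t \<and> \<iota> \<tau> = \<iota> t. \<eta> \<tau>)"
      using t \<eta> by (intro sum_nonneg) auto
    ultimately show ?thesis by (simp add: \<omega>_def \<epsilon>_def)
  qed
  have future: "(\<Sum>\<tau> | \<tau> < t \<and> \<iota> \<tau> = l. \<eta> \<tau>) = 0" if "\<iota> t < l" for t l
  proof -
    have "\<iota> \<tau> \<noteq> l" if "\<tau> < t" for \<tau>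
      using \<iota>_mono[of \<tau> t] that \<open>\<iota> t < l\<close> by simp
    then have none: "{\<tau>. \<tau> < t \<and> \<iota> \<tau> = l} = {}" by blast
    show ?thesis unfolding none by simp
  qed
  have past: "(\<Sum>\<tau> | \<tau> < t \<and> \<iota> \<tau> = l. \<eta> \<tau>) = \<omega> l + \<sigma> l" if t: "t \<le> T" and l: "l < \<iota> t" for t l
  proof -
    have "l < N" using l \<iota>_le[of t] by simp
    define s where "s = inv_into C \<iota> l"
    have s: "s \<in> C" "\<iota> s = l"
      using bij \<open>l < N\<close> by (auto simp: s_def bij_betw_def inv_into_into f_inv_into_f)
    have below: "\<tau> < t" if "\<iota> \<tau> = l" for \<tau>
      using that l \<iota>_mono[of t \<tau>] by (meson not_less)
    have "{\<tau>. \<tau> < t \<and> \<iota> \<tau> = l} = insert s {\<tau>. \<tau> < T \<and> \<tau> \<notin> C \<and> \<iota> \<tau> = l}"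
      using s below t C bij by (auto simp: bij_betw_def inj_on_def dest: less_le_trans)
    then have "(\<Sum>\<tau> | \<tau> < t \<and> \<iota> \<tau> = l. \<eta> \<tau>) = \<eta> s + W l"
      using s by (simp add: W_def)
    then show ?thesis using \<open>l < N\<close> by (simp add: \<omega>_def \<sigma>_def s_def)
  qed
  show ?thesis
  proof (rule that[OF NT])
    fix x0 :: "real vec" assume x0: "x0 \<in> carrier_vec (Suc N)"
    show "\<exists>f\<in>F0L L (Suc N). \<exists>xs\<in>argmin_Rd (Suc N) f. vnorm (x0 - xs) = R \<and>
        L * R\<^sup>2 / (16 * (exp 2 * real (Suc N) ^ 4 * ((b + 4) / (b\<^sup>2 * exp (1 + b))) ^ N)
          * (real T + 1) powr (1 + b)) \<le> f (gd_iter (Suc N) f \<eta> x0 T) - f xs"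
      using hard_function[OF L \<iota>_le \<iota>_T past present future x0] gap
      unfolding K_def by (meson order_trans)
  qed
qed

section \<open>Uniform constants and the conclusion\<close>

lemma polynomial_geometric_bounded:
  fixes \<rho> :: real
  assumes "0 \<le> \<rho>" "\<rho> < 1"
  obtains K where "0 < K" "\<And>n. real (Suc n) ^ 4 * \<rho> ^ n \<le> K"
proof -
  \<comment> \<open>The fourth root turns the expression into the fourth power of
    \<open>Suc n * r ^ n\<close>, which tends to zero.\<close>
  define r where "r = root 4 \<rho>"
  have r: "r ^ 4 = \<rho>" using assms by (simp add: r_def)
  have "norm r < 1" using assms by (simp add: r_def)
  then have "(\<lambda>n. real n * r ^ n + r ^ n) \<longlonglongrightarrow> 0 + 0"
    by (intro tendsto_add LIMSEQ_power_zero) (use powser_times_n_limit_0[of r] in simp_all)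
  then have "(\<lambda>n. (real n * r ^ n + r ^ n) ^ 4) \<longlonglongrightarrow> (0 + 0) ^ 4"
    by (rule tendsto_power)
  moreover have "(real n * r ^ n + r ^ n) ^ 4 = real (Suc n) ^ 4 * \<rho> ^ n" for n
  proof -
    have "real n * r ^ n + r ^ n = real (Suc n) * r ^ n" by (simp add: distrib_right)
    then show ?thesis by (simp only: power_mult_distrib r[symmetric] power_commutes flip: power_mult) (simp add: mult.commute)
  qed
  ultimately have "(\<lambda>n. real (Suc n) ^ 4 * \<rho> ^ n) \<longlonglongrightarrow> 0" by simp
  then have "Bseq (\<lambda>n. real (Suc n) ^ 4 * \<rho> ^ n)" by (intro convergent_imp_Bseq convergentI)
  then obtain K where "0 < K" "\<And>n. norm (real (Suc n) ^ 4 * \<rho> ^ n) \<le> K" by (auto simp: Bseq_def)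
  then show ?thesis by (intro that[of K]) (auto simp: abs_le_iff)
qed

lemma rate_condition:
  fixes p :: real
  assumes "19 / 10 \<le> p" "p < 2"
  shows "(p - 1 + 4) / ((p - 1)\<^sup>2 * exp (1 + (p - 1))) < 1"
proof -
  \<comment> \<open>Quartering the exponent makes the quadratic Taylor bound sharp enough for
    \<open>63 / 10\<close>, and \<open>(9 / 10)\<^sup>2 * (63 / 10)\<close> exceeds
    \<open>5\<close>, hence \<open>p + 3\<close>.\<close>
  have "(1 + 19 / 40 + (19 / 40)\<^sup>2 / 2) ^ 4 \<le> exp (19 / 40 :: real) ^ 4"
    by (intro power_mono exp_lower_Taylor_quadratic) auto
  also have "\<dots> = exp (19 / 10)" by (simp flip: exp_of_nat_mult)
  also have "\<dots> \<le> exp p" using assms by simp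
  finally have e: "63 / 10 \<le> exp p" by (simp add: power2_eq_square field_simps)
  have "(9 / 10)\<^sup>2 \<le> (p - 1)\<^sup>2" using assms by (intro power_mono) auto
  then have "(9 / 10)\<^sup>2 * (63 / 10) \<le> (p - 1)\<^sup>2 * exp p" using e by (intro mult_mono) auto
  then have "5 < (p - 1)\<^sup>2 * exp p" by (simp add: power2_eq_square)
  then show ?thesis using assms by (simp add: divide_less_eq)
qed

theorem theorem2p1:
  fixes p :: real
  assumes "sqrt (2 + sqrt 3) < p" and "p < 2"
  shows "\<exists>c>0. \<forall>(T::nat) (L::real) (R::real) (\<eta>::nat \<Rightarrow> real).
           T \<ge> 1 \<longrightarrow> L > 0 \<longrightarrow> R > 0 \<longrightarrow> (\<forall>t<T. 0 \<le> \<eta> t) \<longrightarrow>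
           (\<exists>d::nat. 1 \<le> d \<and> d \<le> T + 1 \<and>
             (\<forall>x0\<in>carrier_vec d. \<exists>f\<in>F0L L d. \<exists>xs\<in>argmin_Rd d f.
                vnorm (x0 - xs) = R \<and>
                f (gd_iter d f \<eta> x0 T) - f xs \<ge> c * L * R\<^sup>2 * (real T + 1) powr (- p)))"
proof -
  \<comment> \<open>Rounds the lower bound on \<open>p\<close> down to the \<open>19 / 10\<close> of
    \<open>rate_condition\<close>.\<close>
  have "17 / 10 \<le> sqrt (3 :: real)" by (rule real_le_rsqrt) (simp add: power2_eq_square)
  then have "19 / 10 \<le> sqrt (2 + sqrt 3 :: real)" by (intro real_le_rsqrt) (simp add: power2_eq_square)
  then have p: "19 / 10 \<le> p" using assms(1) by linarith
  define b where "b = p - 1"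
  have b: "0 < b" "b \<le> 1" and p_eq: "1 + b = p" using p assms(2) by (auto simp: b_def)
  define \<rho> where "\<rho> = (b + 4) / (b\<^sup>2 * exp (1 + b))"
  have "\<rho> < 1" using rate_condition[OF p assms(2)] by (simp add: \<rho>_def b_def)
  moreover have \<rho>: "0 < \<rho>" using b by (simp add: \<rho>_def)
  ultimately obtain K where K: "0 < K" "\<And>n. real (Suc n) ^ 4 * \<rho> ^ n \<le> K"
    using polynomial_geometric_bounded[of \<rho>] by (metis less_imp_le)
  \<comment> \<open>\<open>K\<close> is uniform in the number of long steps, so \<open>c\<close>
    depends on \<open>p\<close> alone. The \<open>16\<close> combines the \<open>4\<close> of
    \<open>depth_N_sq_ge\<close> with the \<open>4\<close> of \<open>hard_function\<close>.\<close>
  define c where "c = 1 / (16 * (exp 2 * K))"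
  have "0 < c" using K by (simp add: c_def)
  moreover have "\<exists>d::nat. 1 \<le> d \<and> d \<le> T + 1 \<and>
             (\<forall>x0\<in>carrier_vec d. \<exists>f\<in>F0L L d. \<exists>xs\<in>argmin_Rd d f.
                vnorm (x0 - xs) = R \<and>
                f (gd_iter d f \<eta> x0 T) - f xs \<ge> c * L * R\<^sup>2 * (real T + 1) powr (- p))"
    if L: "0 < L" and R: "0 < R" and \<eta>: "\<forall>t<T. 0 \<le> \<eta> t" for T :: nat and L R :: real and \<eta> :: "nat \<Rightarrow> real"
  proof -
    obtain N where N: "N \<le> T"
      and inst: "\<And>x0. x0 \<in> carrier_vec (Suc N) \<Longrightarrow>
        \<exists>f\<in>F0L L (Suc N). \<exists>xs\<in>argmin_Rd (Suc N) f. vnorm (x0 - xs) = R \<and>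
        L * R\<^sup>2 / (16 * (exp 2 * real (Suc N) ^ 4 * \<rho> ^ N) * (real T + 1) powr (1 + b))
          \<le> f (gd_iter (Suc N) f \<eta> x0 T) - f xs"
      using hard_instance[of b L R T \<eta>] b L R \<eta> unfolding \<rho>_def by metis
    have "c * L * R\<^sup>2 * (real T + 1) powr (- p) = L * R\<^sup>2 / (16 * (exp 2 * K) * (real T + 1) powr (1 + b))"
      by (simp add: c_def p_eq powr_minus_divide)
    also have "\<dots> \<le> L * R\<^sup>2 / (16 * (exp 2 * real (Suc N) ^ 4 * \<rho> ^ N) * (real T + 1) powr (1 + b))"
      using K(2)[of N] K(1) L \<rho>
      by (intro divide_left_mono mult_right_mono mult_pos_pos) (auto simp: mult.assoc)
    finally have c_le: "c * L * R\<^sup>2 * (real T + 1) powr (- p)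
        \<le> L * R\<^sup>2 / (16 * (exp 2 * real (Suc N) ^ 4 * \<rho> ^ N) * (real T + 1) powr (1 + b))" .
    show ?thesis
    proof (intro exI[of _ "Suc N"] conjI ballI)
      fix x0 :: "real vec" assume "x0 \<in> carrier_vec (Suc N)"
      then show "\<exists>f\<in>F0L L (Suc N). \<exists>xs\<in>argmin_Rd (Suc N) f. vnorm (x0 - xs) = R \<and>
          c * L * R\<^sup>2 * (real T + 1) powr (- p) \<le> f (gd_iter (Suc N) f \<eta> x0 T) - f xs"
        using inst c_le by (meson order_trans)
    qed (use N in auto)
  qed
  ultimately show ?thesis by blast
qed

end
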